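(* Let $k_G^{\mathbb{C}} := 4/\pi$. (1) If $X \in M_n(\mathbb{C})$ is a positive matrix, then $\|X\|_{cbB} \leq k_G^{\mathbb{C}}\, \|X\|_B$. (2) If $X \in M_{(m,n)}(\mathbb{C})$ is an arbitrary complex $m\times n$ matrix, then $$\|X\|_{cbB} \leq \frac{k_G^{\mathbb{C}}}{2 - k_G^{\mathbb{C}}}\, \|X\|_B.$$
   Context: "Positive" matrix means positive semidefinite. $M_{(m,n)}(\mathbb{C})$ denotes the complex $m\times n$ matrices. Let $\mathcal{A}_n := C(\{1,\dots,n\},\mathbb{C})$ be the $n$-dimensional abelian C*-algebra, i.e. $(\mathbb{C}^n, \|\cdot\|_\infty)$ with pointwise operations. For $X \in M_{(m,n)}(\mathbb{C})$ let $B_X : \mathcal{A}_m \times \mathcal{A}_n \to \mathbb{C}$ be the bilinear form with kernel $X$, $$B_X(a,b) := \sum_{i=1}^m \sum_{j=1}^n a_i X_{(i,j)} b_j.$$ $\|X\|_B$ is the norm of this bilinear form: $\|X\|_B = \sup\{|B_X(a,b)| : \|a\|_\infty \leq 1, \|b\|_\infty \leq 1\}$. $\|X\|_{cbB}$ is the completely bounded norm of $B_X$ in the sense of Christensen and Sinclair: for $k \in \mathbb{N}$ let $(B_X)_k : M_k(\mathcal{A}_m) \times M_k(\mathcal{A}_n) \to M_k(\mathbb{C})$ be given by $$\big((B_X)_k(a,b)\big)_{(s,t)} := \sum_{p=1}^k B_X(a_{(s,p)}, b_{(p,t)}),$$ where $M_k(\mathcal{A}_m)$, $M_k(\mathcal{A}_n)$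 and $M_k(\mathbb{C})$ carry their C*-algebra norms; then $\|X\|_{cbB} := \sup_k \|(B_X)_k\|$, where $\|(B_X)_k\|$ is the norm of the bilinear map $(B_X)_k$. *)

theory Defs
  imports
    "Jordan_Normal_Form.Matrix"
    "HOL-Analysis.L2_Norm"
    "HOL-Library.Extended_Nonnegative_Real"
begin

text \<open>Since all quantities below involve matrix sizes \<open>k\<close> ranging over the natural numbers, matrices
  and vectors are taken with explicit carriers. Indices run from \<open>0\<close>.\<close>

definition kG :: real where
  "kG = 4 / pi"

definition positive_matrix :: "complex mat \<Rightarrow> bool" where
  "positive_matrix X \<longleftrightarrow> square_mat X \<and>
     (\<forall>v \<in> carrier_vec (dim_row X). 0 \<le> (X *\<^sub>v v) \<bullet>c v)"

text \<open>The order on the complex numbers used in \<open>positive_matrix\<close> makes \<open>0 \<le> z\<close> say that \<open>z\<close> is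
  real and nonnegative; over the complex numbers this forces \<open>X\<close> to be Hermitian.\<close>

lemma complex_nonneg_iff: "0 \<le> (z :: complex) \<longleftrightarrow> Im z = 0 \<and> 0 \<le> Re z"
  by (auto simp: less_eq_complex_def)

subsection \<open>The algebras \<open>C({1..n})\<close> and the matrices over them\<close>

text \<open>The algebra \<open>A_n = C({1..n})\<close> is represented by \<open>carrier_vec n\<close>. The inserted \<open>0\<close> only matters
  for \<open>n = 0\<close>, where the algebra, and hence its norm, is zero.\<close>

definition sup_norm :: "complex vec \<Rightarrow> real" where
  "sup_norm a = Max (insert 0 ((\<lambda>i. cmod (a $ i)) ` {..<dim_vec a}))"

definition l2_norm :: "complex vec \<Rightarrow> real" where
  "l2_norm v = L2_set (\<lambda>i. cmod (v $ i)) {..<dim_vec v}"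

text \<open>The C*-norm of \<open>M_k(C)\<close>, i.e. the operator norm on the Hilbert space \<open>C^k\<close>.\<close>

definition op_norm :: "complex mat \<Rightarrow> real" where
  "op_norm A = (SUP v \<in> {v \<in> carrier_vec (dim_col A). l2_norm v \<le> 1}. l2_norm (A *\<^sub>v v))"

lemma bdd_above_op_norm:
  "bdd_above ((\<lambda>v. l2_norm (A *\<^sub>v v)) ` {v \<in> carrier_vec (dim_col A). l2_norm v \<le> 1})"
proof (rule bdd_aboveI2)
  fix v assume v: "v \<in> {v \<in> carrier_vec (dim_col A). l2_norm v \<le> 1}"
  have dv: "dim_vec v = dim_col A" using v by auto
  have comp: "cmod (v $ j) \<le> 1" if "j < dim_col A" for j
    using member_le_L2_set[of "{..<dim_vec v}" j "\<lambda>i. cmod (v $ i)"] that v dv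
    by (auto simp: l2_norm_def)
  have "l2_norm (A *\<^sub>v v) \<le> (\<Sum>i<dim_row A. cmod ((A *\<^sub>v v) $ i))"
    unfolding l2_norm_def dim_mult_mat_vec by (rule L2_set_le_sum) simp
  also have "\<dots> \<le> (\<Sum>i<dim_row A. \<Sum>j<dim_col A. cmod (A $$ (i, j)))"
  proof (rule sum_mono)
    fix i assume "i \<in> {..<dim_row A}"
    then have "(A *\<^sub>v v) $ i = (\<Sum>j<dim_col A. A $$ (i, j) * v $ j)"
      using dv by (simp add: scalar_prod_def lessThan_atLeast0)
    also have "cmod \<dots> \<le> (\<Sum>j<dim_col A. cmod (A $$ (i, j)))"
      by (rule sum_norm_le) (auto simp: norm_mult intro: mult_left_le comp)
    finally show "cmod ((A *\<^sub>v v) $ i) \<le> (\<Sum>j<dim_col A. cmod (A $$ (i, j)))" .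
  qed
  finally show "l2_norm (A *\<^sub>v v) \<le> (\<Sum>i<dim_row A. \<Sum>j<dim_col A. cmod (A $$ (i, j)))" .
qed

text \<open>The set \<open>M_k(A_n)\<close> of \<open>k \<times> k\<close> matrices with entries in \<open>A_n\<close>.\<close>

definition matrices_over :: "nat \<Rightarrow> nat \<Rightarrow> complex vec mat set" where
  "matrices_over k n =
     {a \<in> carrier_mat k k. \<forall>s<k. \<forall>t<k. a $$ (s, t) \<in> carrier_vec n}"

text \<open>The C*-norm of \<open>M_k(A_n)\<close>: under the *-isomorphism \<open>M_k(C({1..n})) = C({1..n}, M_k(C))\<close>,
  evaluating all entries of \<open>a\<close> at the point \<open>i\<close> gives a complex \<open>k \<times> k\<close> matrix, and the norm is the
  maximum over \<open>i\<close> of the operator norms of these matrices.\<close>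

definition matrices_over_norm :: "nat \<Rightarrow> complex vec mat \<Rightarrow> real" where
  "matrices_over_norm n a =
     Max (insert 0 ((\<lambda>i. op_norm (map_mat (\<lambda>x. x $ i) a)) ` {..<n}))"

subsection \<open>Bilinear maps and their norms\<close>

text \<open>Norm of a bilinear map from \<open>S \<times> T\<close>, where \<open>nS\<close>, \<open>nT\<close> and \<open>nR\<close> are the norms of the two
  domains and of the target. The supremum is taken in the extended nonnegative reals, so that it is
  meaningful without knowing in advance that it is finite.\<close>

definition bilinear_norm ::
  "'a set \<Rightarrow> ('a \<Rightarrow> real) \<Rightarrow> 'b set \<Rightarrow> ('b \<Rightarrow> real) \<Rightarrow> ('c \<Rightarrow> real) \<Rightarrow> ('a \<Rightarrow> 'b \<Rightarrow> 'c) \<Rightarrow> ennreal" where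
  "bilinear_norm S nS T nT nR B =
     (SUP (a, b) \<in> {a \<in> S. nS a \<le> 1} \<times> {b \<in> T. nT b \<le> 1}. ennreal (nR (B a b)))"

definition kernel_form :: "complex mat \<Rightarrow> complex vec \<Rightarrow> complex vec \<Rightarrow> complex" where
  "kernel_form X a b = (\<Sum>i<dim_row X. \<Sum>j<dim_col X. a $ i * X $$ (i, j) * b $ j)"

definition amplification ::
  "nat \<Rightarrow> ('a \<Rightarrow> 'b \<Rightarrow> complex) \<Rightarrow> 'a mat \<Rightarrow> 'b mat \<Rightarrow> complex mat" where
  "amplification k B a b = mat k k (\<lambda>(s, t). \<Sum>p<k. B (a $$ (s, p)) (b $$ (p, t)))"

definition norm_B :: "complex mat \<Rightarrow> ennreal" where
  "norm_B X = bilinear_norm (carrier_vec (dim_row X)) sup_norm (carrier_vec (dim_col X)) sup_norm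
     cmod (kernel_form X)"

definition norm_cbB :: "complex mat \<Rightarrow> ennreal" where
  "norm_cbB X = (SUP k \<in> {1..}. bilinear_norm
     (matrices_over k (dim_row X)) (matrices_over_norm (dim_row X))
     (matrices_over k (dim_col X)) (matrices_over_norm (dim_col X))
     op_norm (amplification k (kernel_form X)))"

end

theory Submission
  imports "HOL-Probability.Probability" Defs
begin

text \<open>
  Write \<open>(B_X)_k(a, b) = \<Sum> X_ij a_i b_j\<close> with contractions \<open>a_i\<close>, \<open>b_j\<close> in \<open>M_k\<close>. Pairing with unit vectors
  \<open>\<xi>\<close>, \<open>\<eta>\<close> turns this into \<open>\<Sum> X_ij <u_j, v_i>\<close>, where the vectors \<open>u_j = b_j \<xi>\<close> and \<open>v_i = a_i^* \<eta>\<close> lie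
  in the unit ball of \<open>C^k\<close> (\<open>norm_cbB_le_vector_bound\<close>). What has to be proved is therefore a form of
  Grothendieck's inequality: if \<open>b\<close> bounds \<open>\<bar>\<Sum> X_ij t_j cnj s_i\<bar>\<close> for all scalars in the unit disc, then a
  multiple of \<open>b\<close> bounds \<open>\<bar>\<Sum> X_ij <u_j, v_i>\<bar>\<close>.

  Vectors are rounded to scalars at random. Let \<open>g\<close> be a standard complex Gaussian vector and
  \<open>Z_u = <u, cnj g>\<close>, so that \<open>E Z_u cnj Z_v = <u, v>\<close>. The rounded variable is the phase
  \<open>T_u = \<parallel>u\<parallel> sgn Z_u\<close>, in the unit disc for \<open>u\<close> in the unit ball. The mean modulus is \<open>E \<bar>Z_u\<bar> = (sqrt pi / 2) \<parallel>u\<parallel>\<close>, and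
  differentiating this formula in \<open>u\<close> gives \<open>E Z_v cnj T_u = (sqrt pi / 2) <v, u>\<close>
  (\<open>complex_gauss_phase_covariance\<close>). With the residual \<open>W_u = Z_u - (2 / sqrt pi) T_u\<close> the cross terms
  combine to
    \<open>E W_u cnj W_v = (4 / pi) E T_u cnj T_v - <u, v>\<close>      (\<open>gauss_residual_covariance\<close>).
  Hence \<open>\<Sum> X_ij <u_j, v_i>\<close> is \<open>4 / pi\<close> times an average of scalar values, each bounded by \<open>b\<close>, minus
  \<open>\<Sum> X_ij E W_(u_j) cnj W_(v_i)\<close>, and it remains to control this second sum.

  For positive \<open>X\<close> and \<open>u = v\<close> the second sum is nonnegative and can be dropped, which gives \<open>4 / pi\<close>; the
  case \<open>u \<noteq> v\<close> follows because the form is positive semidefinite (\<open>grothendieck_positive\<close>).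

  For general \<open>X\<close>, the residuals are vectors too: \<open>E \<bar>W_u\<bar>^2 \<le> (4 / pi - 1) \<parallel>u\<parallel>^2\<close>, and their Gram matrix is
  that of vectors in some \<open>C^L\<close> (\<open>psd_matrix_gram_factorization\<close>). So the supremum \<open>S\<close> of
  \<open>\<bar>\<Sum> X_ij <u_j, v_i>\<bar>\<close> over vectors of all dimensions satisfies \<open>S \<le> (4 / pi) b + (4 / pi - 1) S\<close>, that
  is, \<open>(2 - 4 / pi) S \<le> (4 / pi) b\<close> (\<open>grothendieck_general\<close>).
\<close>

(* In what follows v $ i is an entry of a vector with an explicit dimension. *)
unbundle no vec_syntax

section \<open>The Hermitian inner product on complex coordinate sequences\<close>

definition cinner :: "nat \<Rightarrow> (nat \<Rightarrow> complex) \<Rightarrow> (nat \<Rightarrow> complex) \<Rightarrow> complex" where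
  "cinner N u v = (\<Sum>p<N. u p * cnj (v p))"

definition cnorm :: "nat \<Rightarrow> (nat \<Rightarrow> complex) \<Rightarrow> real" where
  "cnorm N u = sqrt (\<Sum>p<N. (cmod (u p))\<^sup>2)"

lemma cnorm_nonneg [simp]: "0 \<le> cnorm N u"
  by (simp add: cnorm_def sum_nonneg)

lemma cnorm_eq_0_iff: "cnorm N u = 0 \<longleftrightarrow> (\<forall>p<N. u p = 0)"
  by (auto simp: cnorm_def sum_nonneg_eq_0_iff)

lemma cnorm_sq: "(cnorm N u)\<^sup>2 = (\<Sum>p<N. (cmod (u p))\<^sup>2)"
  by (simp add: cnorm_def sum_nonneg)

lemma cinner_self: "cinner N u u = complex_of_real ((cnorm N u)\<^sup>2)"
  unfolding cnorm_sq cinner_def by (simp only: of_real_sum complex_norm_square)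

lemma cnorm_unimodular_scale:
  assumes "cmod w = 1" shows "cnorm N (\<lambda>p. w * u p) = cnorm N u"
  using assms by (simp add: cnorm_def norm_mult)

lemma cinner_le: "cmod (cinner N u v) \<le> cnorm N u * cnorm N v"
proof -
  have "cmod (cinner N u v) \<le> (\<Sum>p<N. \<bar>cmod (u p)\<bar> * \<bar>cmod (v p)\<bar>)"
    unfolding cinner_def by (rule sum_norm_le) (simp add: norm_mult)
  also have "\<dots> \<le> cnorm N u * cnorm N v"
    using L2_set_mult_ineq[of "\<lambda>p. cmod (u p)" "\<lambda>p. cmod (v p)" "{..<N}"]
    by (simp add: L2_set_def cnorm_def)
  finally show ?thesis .
qed

lemma cnorm_add_sq:
  "(cnorm N (\<lambda>p. u p + v p))\<^sup>2 = (cnorm N u)\<^sup>2 + 2 * Re (cinner N u v) + (cnorm N v)\<^sup>2"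
proof -
  have "(cmod (a + b))\<^sup>2 = (cmod a)\<^sup>2 + 2 * Re (a * cnj b) + (cmod b)\<^sup>2" for a b :: complex
    unfolding cmod_power2 by (simp add: power2_eq_square algebra_simps)
  then show ?thesis
    by (simp add: cnorm_sq cinner_def sum.distrib sum_distrib_left)
qed

section \<open>Gaussian variables indexed by vectors\<close>

abbreviation std_gauss :: "real measure" where
  "std_gauss \<equiv> density lborel (\<lambda>x. ennreal (std_normal_density x))"

text \<open>One standard normal coordinate for the real and one for the imaginary part of each of the \<open>N\<close>
  complex Gaussian coordinates.\<close>

definition gauss_space :: "nat \<Rightarrow> (nat \<times> bool \<Rightarrow> real) measure" where
  "gauss_space N = PiM ({..<N} \<times> UNIV) (\<lambda>_. std_gauss)"

interpretation std_gauss: prob_space std_gauss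
  by (rule prob_space_normal_density) simp

interpretation gauss_space: prob_space "gauss_space N" for N
  unfolding gauss_space_def by (rule prob_space_PiM) (rule std_gauss.prob_space_axioms)

lemma normal_abs_moments:
  assumes "prob_space M" "distributed M lborel X (normal_density 0 s)" "0 < s"
  shows "integrable M (\<lambda>x. (X x)\<^sup>2)" "(\<integral>x. (X x)\<^sup>2 \<partial>M) = s\<^sup>2"
    and "integrable M (\<lambda>x. \<bar>X x\<bar>)" "(\<integral>x. \<bar>X x\<bar> \<partial>M) = s * sqrt (2 / pi)"
proof -
  interpret prob_space M by fact
  show "integrable M (\<lambda>x. (X x)\<^sup>2)"
    using distributed_integrable[OF assms(2), of "\<lambda>x. x\<^sup>2"] integrable_normal_moment[OF assms(3), of 0 2]
    by simp
  show "integrable M (\<lambda>x. \<bar>X x\<bar>)"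
    using distributed_integrable[OF assms(2), of "\<lambda>x. \<bar>x\<bar>"] integrable_normal_moment_abs[OF assms(3), of 0 1]
    by simp
  show "(\<integral>x. (X x)\<^sup>2 \<partial>M) = s\<^sup>2"
    using normal_distributed_variance[OF assms(3,2)] normal_distributed_expectation[OF assms(3,2)]
    by simp
  show "(\<integral>x. \<bar>X x\<bar> \<partial>M) = s * sqrt (2 / pi)"
    using distributed_integral[OF assms(2), of "\<lambda>x. \<bar>x\<bar>"] integral_normal_moment_abs_odd[OF assms(3), of 0 0]
    by simp
qed

lemma indep_coordinates:
  "prob_space.indep_vars (gauss_space N) (\<lambda>_. borel) (\<lambda>q x. x q) ({..<N} \<times> UNIV)"
proof (cases "N = 0")
  case True
  then show ?thesis
    by (simp add: gauss_space.indep_vars_def gauss_space.indep_sets_def)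
next
  case False
  then have ne: "({..<N} \<times> (UNIV :: bool set)) \<noteq> {}" by auto
  have 1: "distr (gauss_space N) borel (\<lambda>x. x q) = std_gauss" if "q \<in> {..<N} \<times> UNIV" for q
  proof -
    have "distr (gauss_space N) borel (\<lambda>x. x q) = distr (gauss_space N) std_gauss (\<lambda>x. x q)"
      by (rule distr_cong) auto
    then show ?thesis
      using that unfolding gauss_space_def
      by (simp add: distr_PiM_component[OF std_gauss.prob_space_axioms])
  qed
  have 2: "(\<lambda>x. x q) \<in> borel_measurable (gauss_space N)" if "q \<in> {..<N} \<times> UNIV" for q
    unfolding gauss_space_def by (rule measurable_PiM_component_rev[OF that]) simp
  have "distr (gauss_space N) (\<Pi>\<^sub>M i\<in>{..<N} \<times> UNIV. borel) (\<lambda>x. \<lambda>i\<in>{..<N} \<times> UNIV. x i)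
      = distr (gauss_space N) (gauss_space N) (\<lambda>x. x)"
    by (rule distr_cong) (auto simp: gauss_space_def space_PiM PiE_def extensional_restrict
        intro!: sets_PiM_cong)
  also have "\<dots> = (\<Pi>\<^sub>M i\<in>{..<N} \<times> UNIV. distr (gauss_space N) borel (\<lambda>x. x i))"
    unfolding distr_id2 [OF refl] by (subst gauss_space_def) (rule PiM_cong, auto simp: 1)
  finally show ?thesis
    by (subst gauss_space.indep_vars_iff_distr_eq_PiM'[OF ne 2]) auto
qed

text \<open>The real part of \<open>complex_gauss\<close> below. Every real linear functional of the Gaussian vector
  has this form, so that these variables carry all distributional information that is used.\<close>

definition real_gauss :: "nat \<Rightarrow> (nat \<Rightarrow> complex) \<Rightarrow> (nat \<times> bool \<Rightarrow> real) \<Rightarrow> real" where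
  "real_gauss N u x = (\<Sum>p<N. Re (u p) * x (p, True) - Im (u p) * x (p, False)) / sqrt 2"

lemma real_gauss_measurable [measurable]: "real_gauss N u \<in> borel_measurable (gauss_space N)"
proof -
  have "(\<lambda>x. x q) \<in> borel_measurable (gauss_space N)" if "q \<in> {..<N} \<times> UNIV" for q
    unfolding gauss_space_def by (rule measurable_PiM_component_rev[OF that]) simp
  then show ?thesis unfolding real_gauss_def
    by (intro borel_measurable_divide borel_measurable_sum borel_measurable_diff borel_measurable_times) auto
qed

text \<open>A linear combination of independent normal variables is normal, with variance the sum of the
  squared coefficients.\<close>

lemma real_gauss_distributed:
  assumes "cnorm N u \<noteq> 0"
  shows "distributed (gauss_space N) lborel (real_gauss N u) (normal_density 0 (cnorm N u / sqrt 2))"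
proof -
  define a where "a q = (if snd q then Re (u (fst q)) else - Im (u (fst q))) / sqrt 2" for q
  \<comment> \<open>The theorem on sums of independent normal variables asks for positive variances, hence zero
    coefficients are left out.\<close>
  define J where "J = {q \<in> {..<N} \<times> (UNIV::bool set). a q \<noteq> 0}"
  have fin: "finite J" by (simp add: J_def)
  have sumJ: "(\<Sum>q\<in>J. f q) = (\<Sum>p<N. f (p, True) + f (p, False))"
    if "\<And>q. a q = 0 \<Longrightarrow> f q = 0" for f :: "nat \<times> bool \<Rightarrow> real"
  proof -
    have "(\<Sum>q\<in>J. f q) = (\<Sum>q\<in>{..<N} \<times> UNIV. f q)"
      by (rule sum.mono_neutral_left) (auto simp: J_def that)
    also have "\<dots> = (\<Sum>p<N. \<Sum>b\<in>UNIV. f (p, b))"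
      by (simp add: sum.cartesian_product)
    finally show ?thesis by (simp add: UNIV_bool add.commute)
  qed
  have Rsum: "real_gauss N u = (\<lambda>x. \<Sum>q\<in>J. a q * x q)"
    by (subst sumJ) (auto simp: real_gauss_def a_def sum_divide_distrib diff_divide_distrib)
  have var: "(\<Sum>q\<in>J. \<bar>a q\<bar>\<^sup>2) = (cnorm N u / sqrt 2)\<^sup>2"
    by (subst sumJ)
      (auto simp: a_def power_divide cnorm_sq cmod_power2 sum_divide_distrib add_divide_distrib)
  have ne: "J \<noteq> {}" using var assms by auto
  have coord: "distributed (gauss_space N) lborel (\<lambda>x. x q) std_normal_density"
    if "q \<in> {..<N} \<times> UNIV" for q
  proof -
    have "distr (gauss_space N) lborel (\<lambda>x. x q) = distr (gauss_space N) std_gauss (\<lambda>x. x q)"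
      by (rule distr_cong) auto
    also have "\<dots> = std_gauss"
      using that unfolding gauss_space_def
      by (simp add: distr_PiM_component[OF std_gauss.prob_space_axioms])
    finally show ?thesis unfolding distributed_def
      using measurable_PiM_component_rev[OF that, of "\<lambda>x. x" "\<lambda>_. std_gauss" lborel]
      by (auto simp: gauss_space_def)
  qed
  have "gauss_space.indep_vars N (\<lambda>_. borel) (\<lambda>q x. a q * x q) J"
    by (rule gauss_space.indep_vars_compose2[OF gauss_space.indep_vars_subset[OF indep_coordinates],
          where Y="\<lambda>q z. a q * z"]) (auto simp: J_def)
  moreover have "distributed (gauss_space N) lborel (\<lambda>x. a q * x q) (normal_density 0 \<bar>a q\<bar>)"
    if "q \<in> J" for q
    using gauss_space.normal_density_affine[OF coord, of q "a q" 0] that by (auto simp: J_def)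
  ultimately have "distributed (gauss_space N) lborel (\<lambda>x. \<Sum>q\<in>J. a q * x q)
      (normal_density (\<Sum>q\<in>J. 0) (sqrt (\<Sum>q\<in>J. \<bar>a q\<bar>\<^sup>2)))"
    by (intro gauss_space.sum_indep_normal[OF fin ne]) (auto simp: J_def)
  then show ?thesis unfolding Rsum var by (simp add: real_sqrt_abs)
qed

lemma real_gauss_zero: "cnorm N u = 0 \<Longrightarrow> real_gauss N u x = 0"
  by (simp add: cnorm_eq_0_iff real_gauss_def)

lemma real_gauss_moments:
  shows "integrable (gauss_space N) (\<lambda>x. (real_gauss N u x)\<^sup>2)"
    and "(\<integral>x. (real_gauss N u x)\<^sup>2 \<partial>gauss_space N) = (cnorm N u)\<^sup>2 / 2"
    and "integrable (gauss_space N) (\<lambda>x. \<bar>real_gauss N u x\<bar>)"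
    and "(\<integral>x. \<bar>real_gauss N u x\<bar> \<partial>gauss_space N) = cnorm N u / sqrt pi"
proof -
  have "integrable (gauss_space N) (\<lambda>x. (real_gauss N u x)\<^sup>2)
    \<and> (\<integral>x. (real_gauss N u x)\<^sup>2 \<partial>gauss_space N) = (cnorm N u)\<^sup>2 / 2
    \<and> integrable (gauss_space N) (\<lambda>x. \<bar>real_gauss N u x\<bar>)
    \<and> (\<integral>x. \<bar>real_gauss N u x\<bar> \<partial>gauss_space N) = cnorm N u / sqrt pi"
  proof (cases "cnorm N u = 0")
    case True
    then show ?thesis by (simp add: real_gauss_zero)
  next
    case False
    then have "0 < cnorm N u / sqrt 2" by (simp add: less_le)
    note m = normal_abs_moments[OF gauss_space.prob_space_axioms real_gauss_distributed[OF False] this]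
    then show ?thesis by (simp add: power_divide real_sqrt_divide)
  qed
  then show "integrable (gauss_space N) (\<lambda>x. (real_gauss N u x)\<^sup>2)"
    and "(\<integral>x. (real_gauss N u x)\<^sup>2 \<partial>gauss_space N) = (cnorm N u)\<^sup>2 / 2"
    and "integrable (gauss_space N) (\<lambda>x. \<bar>real_gauss N u x\<bar>)"
    and "(\<integral>x. \<bar>real_gauss N u x\<bar> \<partial>gauss_space N) = cnorm N u / sqrt pi" by auto
qed

definition complex_gauss :: "nat \<Rightarrow> (nat \<Rightarrow> complex) \<Rightarrow> (nat \<times> bool \<Rightarrow> real) \<Rightarrow> complex" where
  "complex_gauss N u x = (\<Sum>p<N. u p * Complex (x (p, True)) (x (p, False))) / sqrt 2"

lemma complex_gauss_add:
  "complex_gauss N (\<lambda>p. u p + v p) x = complex_gauss N u x + complex_gauss N v x"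
  by (simp add: complex_gauss_def ring_distribs sum.distrib add_divide_distrib)

lemma complex_gauss_scale:
  "complex_gauss N (\<lambda>p. c * u p) x = c * complex_gauss N u x"
  by (simp add: complex_gauss_def mult.assoc sum_distrib_left)

lemma Re_complex_gauss: "Re (complex_gauss N u x) = real_gauss N u x"
  by (simp add: complex_gauss_def real_gauss_def Re_divide_of_real)

lemma Im_complex_gauss: "Im (complex_gauss N u x) = real_gauss N (\<lambda>p. - \<i> * u p) x"
  unfolding Re_complex_gauss[symmetric] complex_gauss_scale by simp

lemma complex_gauss_measurable [measurable]:
  "complex_gauss N u \<in> borel_measurable (gauss_space N)"
  unfolding borel_measurable_complex_iff[of "complex_gauss N u"]
  by (simp add: Re_complex_gauss Im_complex_gauss cong: measurable_cong)

text \<open>By polarization, since the variances at \<open>u\<close>, \<open>v\<close> and \<open>u + v\<close> are known.\<close>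

lemma real_gauss_covariance:
  "has_bochner_integral (gauss_space N) (\<lambda>x. real_gauss N u x * real_gauss N v x) (Re (cinner N u v) / 2)"
proof -
  let ?w = "\<lambda>p. u p + v p"
  have h: "has_bochner_integral (gauss_space N) (\<lambda>x. (real_gauss N u x)\<^sup>2) ((cnorm N u)\<^sup>2 / 2)" for u
    using real_gauss_moments(1,2)[of N u] by (simp add: has_bochner_integral_iff)
  have add: "real_gauss N ?w x = real_gauss N u x + real_gauss N v x" for x
    unfolding Re_complex_gauss[symmetric] complex_gauss_add by simp
  have "has_bochner_integral (gauss_space N)
     (\<lambda>x. ((real_gauss N ?w x)\<^sup>2 - (real_gauss N u x)\<^sup>2 - (real_gauss N v x)\<^sup>2) / 2)
     (((cnorm N ?w)\<^sup>2 / 2 - (cnorm N u)\<^sup>2 / 2 - (cnorm N v)\<^sup>2 / 2) / 2)"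
    by (intro has_bochner_integral_divide has_bochner_integral_diff h)
  moreover have "((real_gauss N ?w x)\<^sup>2 - (real_gauss N u x)\<^sup>2 - (real_gauss N v x)\<^sup>2) / 2
      = real_gauss N u x * real_gauss N v x" for x
    unfolding add by (simp add: power2_eq_square algebra_simps)
  moreover have "((cnorm N ?w)\<^sup>2 / 2 - (cnorm N u)\<^sup>2 / 2 - (cnorm N v)\<^sup>2 / 2) / 2 = Re (cinner N u v) / 2"
    unfolding cnorm_add_sq by (simp add: field_simps)
  ultimately show ?thesis by (simp only:)
qed

text \<open>Both the real and the imaginary part of the product are sums of two products of real Gaussians,
  because the imaginary part of \<open>complex_gauss N u\<close> is the real part at \<open>- \<i> u\<close>.\<close>

lemma complex_gauss_covariance:
  "has_bochner_integral (gauss_space N)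
    (\<lambda>x. complex_gauss N u x * cnj (complex_gauss N v x)) (cinner N u v)"
proof -
  let ?iu = "\<lambda>p. - \<i> * u p" and ?iv = "\<lambda>p. - \<i> * v p"
  have scale: "cinner N ?iu v = - \<i> * cinner N u v" "cinner N u ?iv = \<i> * cinner N u v"
    "cinner N ?iu ?iv = cinner N u v"
    by (simp_all add: cinner_def sum_distrib_left sum_negf algebra_simps)
  let ?A = "\<lambda>x. real_gauss N u x * real_gauss N v x + real_gauss N ?iu x * real_gauss N ?iv x"
  let ?B = "\<lambda>x. real_gauss N ?iu x * real_gauss N v x - real_gauss N u x * real_gauss N ?iv x"
  have "has_bochner_integral (gauss_space N) (\<lambda>x. of_real (?A x) + \<i> * of_real (?B x))
     (of_real (Re (cinner N u v) / 2 + Re (cinner N ?iu ?iv) / 2)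
      + \<i> * of_real (Re (cinner N ?iu v) / 2 - Re (cinner N u ?iv) / 2))"
    by (intro has_bochner_integral_add has_bochner_integral_diff has_bochner_integral_of_real
        has_bochner_integral_mult_right real_gauss_covariance)
  moreover have "of_real (?A x) + \<i> * of_real (?B x)
      = complex_gauss N u x * cnj (complex_gauss N v x)" for x
    by (rule complex_eqI) (simp_all add: Re_complex_gauss Im_complex_gauss)
  moreover have "of_real (Re (cinner N u v) / 2 + Re (cinner N ?iu ?iv) / 2)
      + \<i> * of_real (Re (cinner N ?iu v) / 2 - Re (cinner N u ?iv) / 2) = cinner N u v"
    unfolding scale by (rule complex_eqI) simp_all
  ultimately show ?thesis by (simp only:)
qed

section \<open>The mean modulus of a complex Gaussian\<close>

text \<open>The function \<open>a cos t + b sin t\<close> is a shifted sine with amplitude \<open>sqrt (a^2 + b^2)\<close>; its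
  absolute value has the same integral over each half period. For \<open>z = a + \<i> b\<close> this recovers the
  modulus of \<open>z\<close> from the real parts of the rotations of \<open>z\<close>.\<close>

lemma abs_trig_has_integral:
  fixes a b :: real
  shows "((\<lambda>t. \<bar>a * cos t + b * sin t\<bar>) has_integral 2 * sqrt (a\<^sup>2 + b\<^sup>2)) {0..pi}"
proof -
  have *: "((\<lambda>t. \<bar>a * cos t + b * sin t\<bar>) has_integral 2 * sqrt (a\<^sup>2 + b\<^sup>2)) {0..pi}"
    if "a \<le> 0" for a b :: real
  proof (cases "a = 0 \<and> b = 0")
    case True
    then show ?thesis by simp
  next
    case False
    define r where "r = sqrt (a\<^sup>2 + b\<^sup>2)"
    have r: "0 < r" using False by (auto simp: r_def sum_power2_gt_zero_iff)
    have r2: "r\<^sup>2 = a\<^sup>2 + b\<^sup>2" by (simp add: r_def)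
    have "\<bar>b\<bar> \<le> r" unfolding r_def by (rule real_le_rsqrt) simp
    then have br: "-1 \<le> b / r" "b / r \<le> 1" using r by (auto simp: field_simps abs_le_iff)
    define w where "w = arccos (b / r)"
    have w: "0 \<le> w" "w \<le> pi" unfolding w_def using br by (auto intro: arccos_lbound arccos_ubound)
    have cw: "b = r * cos w" using r br by (simp add: w_def)
    have "r\<^sup>2 * (sin w)\<^sup>2 = a\<^sup>2"
      using r2 unfolding cw sin_squared_eq by (simp add: power_mult_distrib algebra_simps)
    then have "(r * sin w)\<^sup>2 = (- a)\<^sup>2" by (simp add: power_mult_distrib)
    then have sw: "a = - (r * sin w)"
      using that r w sin_ge_zero[of w] by (subst (asm) power2_eq_iff_nonneg) auto
    \<comment> \<open>The sign of \<open>a\<close> puts the zero \<open>w\<close> of the shifted sine inside the interval, which is split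
      there.\<close>
    have eq: "a * cos t + b * sin t = r * sin (t - w)" for t
      unfolding cw sw sin_diff by (simp add: algebra_simps)
    have "((\<lambda>t. \<bar>a * cos t + b * sin t\<bar>) has_integral (r * cos (w - w) - r * cos (w - 0))) {0..w}"
    proof (rule has_integral_eq[rotated, OF fundamental_theorem_of_calculus])
      show "((\<lambda>t. r * cos (w - t)) has_vector_derivative r * sin (w - t)) (at t within {0..w})" for t
        unfolding has_real_derivative_iff_has_vector_derivative[symmetric]
        by (auto intro!: derivative_eq_intros)
      show "r * sin (w - t) = \<bar>a * cos t + b * sin t\<bar>" if "t \<in> {0..w}" for t
      proof -
        have "0 \<le> sin (w - t)" using that w by (intro sin_ge_zero) auto
        moreover have "sin (t - w) = - sin (w - t)" using sin_minus[of "w - t"] by simp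
        ultimately show ?thesis unfolding eq using r by (simp add: abs_mult)
      qed
    qed (use w in auto)
    moreover have "((\<lambda>t. \<bar>a * cos t + b * sin t\<bar>) has_integral
        (- r * cos (pi - w) - (- r * cos (w - w)))) {w..pi}"
    proof (rule has_integral_eq[rotated, OF fundamental_theorem_of_calculus])
      show "((\<lambda>t. - r * cos (t - w)) has_vector_derivative r * sin (t - w)) (at t within {w..pi})" for t
        unfolding has_real_derivative_iff_has_vector_derivative[symmetric]
        by (auto intro!: derivative_eq_intros)
      show "r * sin (t - w) = \<bar>a * cos t + b * sin t\<bar>" if "t \<in> {w..pi}" for t
      proof -
        have "0 \<le> sin (t - w)" using that w by (intro sin_ge_zero) auto
        then show ?thesis unfolding eq using r by (simp add: abs_mult)
      qed
    qed (use w in auto)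
    ultimately have "((\<lambda>t. \<bar>a * cos t + b * sin t\<bar>) has_integral
        (r * cos (w - w) - r * cos (w - 0)) + (- r * cos (pi - w) - (- r * cos (w - w)))) {0..pi}"
      by (rule has_integral_combine[OF w])
    then show ?thesis by (simp add: r_def[symmetric] cos_diff)
  qed
  show ?thesis
  proof (cases "a \<le> 0")
    case False
    have "\<bar>(- a) * cos t + (- b) * sin t\<bar> = \<bar>a * cos t + b * sin t\<bar>" for t
      using abs_minus_cancel[of "a * cos t + b * sin t"] by (simp add: algebra_simps)
    then show ?thesis using *[of "- a" "- b"] False by simp
  qed (rule *)
qed

text \<open>The joint law of real and imaginary part is avoided: the modulus is half the integral of
  \<open>\<bar>Re (cis (- t) z)\<bar>\<close> over \<open>0 \<le> t \<le> pi\<close>, and for each \<open>t\<close> that real part is a real Gaussian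
  variable whose first absolute moment is \<open>cnorm N u / sqrt pi\<close>. Tonelli's theorem exchanges the two
  integrals.\<close>

lemma complex_gauss_norm_integral:
  "has_bochner_integral (gauss_space N) (\<lambda>x. cmod (complex_gauss N u x)) (sqrt pi / 2 * cnorm N u)"
proof -
  define R where "R = real_gauss N u"
  define I where "I = real_gauss N (\<lambda>p. - \<i> * u p)"
  have [measurable]: "R \<in> borel_measurable (gauss_space N)" "I \<in> borel_measurable (gauss_space N)"
    by (simp_all add: R_def I_def)
  have Re: "Re (complex_gauss N u x) = R x" and Im: "Im (complex_gauss N u x) = I x" for x
    by (simp_all only: R_def I_def Re_complex_gauss Im_complex_gauss)
  interpret P: pair_sigma_finite lborel "gauss_space N"
    by unfold_locales
  have rot: "\<bar>R x * cos t + I x * sin t\<bar> = \<bar>real_gauss N (\<lambda>p. cis (- t) * u p) x\<bar>" for t x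
    unfolding Re_complex_gauss[symmetric] complex_gauss_scale by (simp add: Re Im algebra_simps)
  have inner: "(\<integral>\<^sup>+x. ennreal \<bar>R x * cos t + I x * sin t\<bar> \<partial>gauss_space N)
      = ennreal (cnorm N u / sqrt pi)" for t
  proof -
    have "cnorm N (\<lambda>p. cis (- t) * u p) = cnorm N u" by (rule cnorm_unimodular_scale) simp
    then show ?thesis unfolding rot
      by (subst nn_integral_eq_integral) (simp_all add: real_gauss_moments)
  qed
  have norm: "ennreal (2 * cmod (complex_gauss N u x))
      = (\<integral>\<^sup>+t. ennreal (indicator {0..pi} t * \<bar>R x * cos t + I x * sin t\<bar>) \<partial>lborel)" for x
  proof -
    have c: "cmod (complex_gauss N u x) = sqrt ((R x)\<^sup>2 + (I x)\<^sup>2)"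
      by (simp add: cmod_def Re Im)
    show ?thesis unfolding c
      by (rule nn_integral_has_integral_lebesgue[symmetric, OF _ abs_trig_has_integral]) auto
  qed
  have "(\<integral>\<^sup>+x. ennreal (2 * cmod (complex_gauss N u x)) \<partial>gauss_space N)
     = (\<integral>\<^sup>+t. \<integral>\<^sup>+x. ennreal (indicator {0..pi} t * \<bar>R x * cos t + I x * sin t\<bar>) \<partial>gauss_space N \<partial>lborel)"
    unfolding norm by (rule P.Fubini') measurable
  also have "\<dots> = (\<integral>\<^sup>+t. ennreal (cnorm N u / sqrt pi) * indicator {0..pi} t \<partial>lborel)"
    by (rule nn_integral_cong) (auto simp: inner split: split_indicator)
  also have "\<dots> = ennreal (cnorm N u / sqrt pi * pi)"
    by (subst nn_integral_cmult_indicator) (simp_all add: ennreal_mult[symmetric])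
  also have "cnorm N u / sqrt pi * pi = 2 * (sqrt pi / 2 * cnorm N u)"
    by (simp add: field_simps)
  finally have *: "(\<integral>\<^sup>+x. ennreal (2 * cmod (complex_gauss N u x)) \<partial>gauss_space N)
     = ennreal (2 * (sqrt pi / 2 * cnorm N u))" .
  have "has_bochner_integral (gauss_space N) (\<lambda>x. 2 * cmod (complex_gauss N u x)) (2 * (sqrt pi / 2 * cnorm N u))"
    by (rule has_bochner_integral_nn_integral[OF _ _ _ *]) auto
  from has_bochner_integral_divide[OF this, of 2] show ?thesis by simp
qed

section \<open>Correlation of a Gaussian with its own phase\<close>

lemma cnj_measurable [measurable]: "cnj \<in> borel_measurable borel"
  by (intro borel_measurable_continuous_onI continuous_intros)

lemma Re_of_real_mult: "Re (of_real t * z) = t * Re z"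
  by simp

text \<open>The derivative at \<open>t = 0\<close> of a function with a minimum there vanishes, in the form in which it is
  needed.\<close>

lemma linear_le_quadratic_imp_zero:
  fixes d K :: real
  assumes "\<And>t. t * d \<le> t\<^sup>2 * K"
  shows "d = 0"
proof (rule ccontr)
  assume "d \<noteq> 0"
  define L where "L = \<bar>K\<bar> + 1"
  have L: "0 < L" "K < L" by (auto simp: L_def)
  have "d / L * d \<le> (d / L)\<^sup>2 * K" by (rule assms)
  then have "d\<^sup>2 * L \<le> d\<^sup>2 * K" using L by (simp add: power2_eq_square field_simps)
  then show False using L \<open>d \<noteq> 0\<close> by simp
qed

lemma mult_cnj_sgn: "z * cnj (sgn z) = complex_of_real (cmod z)"
proof (cases "z = 0")
  case False
  have "z * cnj (sgn z) = z * cnj z / of_real (cmod z)" by (simp add: sgn_eq)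
  also have "\<dots> = of_real (cmod z)"
    using False by (simp add: complex_norm_square[symmetric] power2_eq_square)
  finally show ?thesis .
qed simp

lemma complex_gauss_integrable [simp]: "integrable (gauss_space N) (complex_gauss N u)"
  using complex_gauss_norm_integral[of N u]
  by (subst integrable_norm_iff[symmetric]) (auto simp: has_bochner_integral_iff)

lemma complex_gauss_mult_sgn_integrable:
  "integrable (gauss_space N) (\<lambda>x. complex_gauss N v x * cnj (sgn (complex_gauss N u x)))"
proof (rule Bochner_Integration.integrable_bound)
  show "integrable (gauss_space N) (complex_gauss N v)" by simp
  show "(\<lambda>x. complex_gauss N v x * cnj (sgn (complex_gauss N u x))) \<in> borel_measurable (gauss_space N)"
    unfolding sgn_eq complex_cnj_divide by measurable
qed (auto simp: norm_mult norm_sgn)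

text \<open>The expectation is the derivative of \<open>E \<bar>Z\<bar>\<close> at \<open>u\<close> in direction \<open>v\<close>, and this mean modulus is
  known to be a multiple of the Euclidean norm. Instead of differentiating under the integral, one
  uses that \<open>sgn z\<close> is a subgradient of the modulus at \<open>z\<close>: integrating the subgradient inequality
  at \<open>u + t v\<close> bounds a linear function of \<open>t\<close> by a quadratic one for all real \<open>t\<close>.\<close>

lemma complex_gauss_sgn_Re:
  assumes u: "cnorm N u \<noteq> 0"
  shows "(\<integral>x. Re (complex_gauss N v x * cnj (sgn (complex_gauss N u x))) \<partial>gauss_space N)
    = sqrt pi / 2 * Re (cinner N v u) / cnorm N u" (is "?D = _")
proof -
  define a where "a = cnorm N u"
  have a: "0 < a" using u by (simp add: a_def less_le)
  let ?c = "sqrt pi / 2"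
  have int: "integrable (gauss_space N) (\<lambda>x. cmod (complex_gauss N w x))"
    "(\<integral>x. cmod (complex_gauss N w x) \<partial>gauss_space N) = ?c * cnorm N w" for w
    using complex_gauss_norm_integral[of N w] by (auto simp: has_bochner_integral_iff)
  have "t * (?D - ?c * Re (cinner N v u) / a) \<le> t\<^sup>2 * (?c * (cnorm N v)\<^sup>2 / (2 * a))" for t
  proof -
    let ?tv = "\<lambda>p. of_real t * v p"
    let ?w = "\<lambda>p. u p + ?tv p"
    have pw: "cmod (complex_gauss N u x) + t * Re (complex_gauss N v x * cnj (sgn (complex_gauss N u x)))
        \<le> cmod (complex_gauss N ?w x)" for x
    proof -
      let ?s = "cnj (sgn (complex_gauss N u x))"
      have "cmod (complex_gauss N u x) + t * Re (complex_gauss N v x * ?s)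
        = Re (complex_gauss N u x * ?s + of_real t * (complex_gauss N v x * ?s))"
        by (simp only: mult_cnj_sgn plus_complex.sel Re_complex_of_real Re_of_real_mult)
      also have "\<dots> = Re (complex_gauss N ?w x * ?s)"
        unfolding complex_gauss_add complex_gauss_scale by (simp add: algebra_simps)
      also have "\<dots> \<le> cmod (complex_gauss N ?w x * ?s)" by (rule complex_Re_le_cmod)
      also have "\<dots> \<le> cmod (complex_gauss N ?w x)" by (simp add: norm_mult norm_sgn)
      finally show ?thesis .
    qed
    have "?c * a + t * ?D = (\<integral>x. cmod (complex_gauss N u x)
        + t * Re (complex_gauss N v x * cnj (sgn (complex_gauss N u x))) \<partial>gauss_space N)"
      using int[of u] complex_gauss_mult_sgn_integrable[of N v u] by (simp add: a_def del: times_complex.sel)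
    also have "\<dots> \<le> (\<integral>x. cmod (complex_gauss N ?w x) \<partial>gauss_space N)"
      using int(1) complex_gauss_mult_sgn_integrable[of N v u]
      by (intro integral_mono pw Bochner_Integration.integrable_add integrable_mult_right integrable_Re)
    also have "\<dots> = ?c * cnorm N ?w" by (rule int)
    \<comment> \<open>The arithmetic-geometric mean inequality replaces the norm by its square, which is a
      polynomial in \<open>t\<close>; it is an equality at \<open>t = 0\<close>, so that the derivative is unaffected.\<close>
    also have "\<dots> \<le> ?c * ((a\<^sup>2 + (cnorm N ?w)\<^sup>2) / (2 * a))"
    proof (rule mult_left_mono)
      have "0 \<le> (a - cnorm N ?w)\<^sup>2" by simp
      then show "cnorm N ?w \<le> (a\<^sup>2 + (cnorm N ?w)\<^sup>2) / (2 * a)"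
        using a by (simp add: field_simps power2_eq_square)
    qed simp
    also have "(cnorm N ?w)\<^sup>2 = a\<^sup>2 + 2 * t * Re (cinner N v u) + t\<^sup>2 * (cnorm N v)\<^sup>2"
    proof -
      have "cinner N u ?tv = of_real t * cnj (cinner N v u)"
        by (simp add: cinner_def sum_distrib_left algebra_simps)
      moreover have "(cnorm N ?tv)\<^sup>2 = t\<^sup>2 * (cnorm N v)\<^sup>2"
        by (simp add: cnorm_sq norm_mult power_mult_distrib sum_distrib_left)
      ultimately show ?thesis unfolding cnorm_add_sq by (simp add: a_def)
    qed
    finally have "?c * a + t * ?D
        \<le> ?c * ((a\<^sup>2 + (a\<^sup>2 + 2 * t * Re (cinner N v u) + t\<^sup>2 * (cnorm N v)\<^sup>2)) / (2 * a))" .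
    also have "\<dots> = ?c * a + t * (?c * Re (cinner N v u) / a) + t\<^sup>2 * (?c * (cnorm N v)\<^sup>2 / (2 * a))"
      using a by (simp add: field_simps power2_eq_square)
    finally show ?thesis unfolding right_diff_distrib by linarith
  qed
  then have "?D - ?c * Re (cinner N v u) / a = 0" by (rule linear_le_quadratic_imp_zero)
  then show ?thesis by (simp add: a_def)
qed

lemma complex_gauss_sgn:
  assumes u: "cnorm N u \<noteq> 0"
  shows "(\<integral>x. complex_gauss N v x * cnj (sgn (complex_gauss N u x)) \<partial>gauss_space N)
    = of_real (sqrt pi / 2 / cnorm N u) * cinner N v u" (is "?D = ?E")
proof (rule complex_eqI)
  have Re: "Re (\<integral>x. complex_gauss N v x * cnj (sgn (complex_gauss N u x)) \<partial>gauss_space N)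
    = Re (of_real (sqrt pi / 2 / cnorm N u) * cinner N v u)" for v
    unfolding integral_Re[OF complex_gauss_mult_sgn_integrable, symmetric] complex_gauss_sgn_Re[OF u]
      Re_of_real_mult by simp
  then show "Re ?D = Re ?E" .
  let ?iv = "\<lambda>p. - \<i> * v p"
  have "Re (- \<i> * ?D) = Re (- \<i> * ?E)"
  proof -
    have "- \<i> * ?D = (\<integral>x. complex_gauss N ?iv x * cnj (sgn (complex_gauss N u x)) \<partial>gauss_space N)"
      unfolding complex_gauss_scale mult.assoc
      by (rule integral_mult_right_zero[symmetric])
    moreover have "cinner N ?iv u = - \<i> * cinner N v u"
      by (simp add: cinner_def sum_distrib_left sum_negf algebra_simps)
    ultimately show ?thesis using Re[of ?iv] by (simp only: mult.left_commute)
  qed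
  then show "Im ?D = Im ?E" by simp
qed

section \<open>Rounding vectors to scalars, and the residual\<close>

text \<open>The factor \<open>cnorm N u\<close> makes the covariance of Gaussian and phase homogeneous in \<open>u\<close>, so that
  vectors need not be normalized; for \<open>u\<close> in the unit ball the values lie in the unit disc.\<close>

definition gauss_phase :: "nat \<Rightarrow> (nat \<Rightarrow> complex) \<Rightarrow> (nat \<times> bool \<Rightarrow> real) \<Rightarrow> complex" where
  "gauss_phase N u x = of_real (cnorm N u) * sgn (complex_gauss N u x)"

lemma gauss_phase_norm: "cmod (gauss_phase N u x) \<le> cnorm N u"
  by (simp add: gauss_phase_def norm_mult norm_sgn)

lemma gauss_phase_measurable [measurable]:
  "gauss_phase N u \<in> borel_measurable (gauss_space N)"
  unfolding gauss_phase_def sgn_eq by measurable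

lemma gauss_phase_covariance_integrable:
  "integrable (gauss_space N) (\<lambda>x. gauss_phase N u x * cnj (gauss_phase N v x))"
  by (rule gauss_space.integrable_const_bound[where B="cnorm N u * cnorm N v"])
    (auto simp: norm_mult intro!: mult_mono gauss_phase_norm)

lemma complex_gauss_phase_covariance:
  "has_bochner_integral (gauss_space N) (\<lambda>x. complex_gauss N v x * cnj (gauss_phase N u x))
    (of_real (sqrt pi / 2) * cinner N v u)"
proof -
  have eq: "complex_gauss N v x * cnj (gauss_phase N u x)
      = of_real (cnorm N u) * (complex_gauss N v x * cnj (sgn (complex_gauss N u x)))" for x
    by (simp add: gauss_phase_def)
  have z: "of_real (cnorm N u) * (\<integral>x. complex_gauss N v x * cnj (sgn (complex_gauss N u x)) \<partial>gauss_space N)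
      = of_real (sqrt pi / 2) * cinner N v u"
  proof (cases "cnorm N u = 0")
    case True
    then show ?thesis by (simp add: cnorm_eq_0_iff cinner_def)
  next
    case False
    then show ?thesis unfolding complex_gauss_sgn[OF False] by simp
  qed
  show ?thesis unfolding eq z[symmetric]
    by (intro has_bochner_integral_mult_right has_bochner_integral_integrable
        complex_gauss_mult_sgn_integrable)
qed

text \<open>The coefficient \<open>2 / sqrt pi\<close> is the inverse of the covariance factor of Gaussian and phase. Each
  of the two cross terms in the covariance of residuals is then exactly \<open>- cinner N u v\<close>, and no error
  term is left.\<close>

definition gauss_residual :: "nat \<Rightarrow> (nat \<Rightarrow> complex) \<Rightarrow> (nat \<times> bool \<Rightarrow> real) \<Rightarrow> complex" where
  "gauss_residual N u x = complex_gauss N u x - of_real (2 / sqrt pi) * gauss_phase N u x"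

lemma gauss_residual_covariance:
  "has_bochner_integral (gauss_space N) (\<lambda>x. gauss_residual N u x * cnj (gauss_residual N v x))
    (of_real (4 / pi) * (\<integral>x. gauss_phase N u x * cnj (gauss_phase N v x) \<partial>gauss_space N)
      - cinner N u v)"
proof -
  let ?k = "complex_of_real (2 / sqrt pi)" and ?m = "complex_of_real (sqrt pi / 2)"
  let ?T = "\<integral>x. gauss_phase N u x * cnj (gauss_phase N v x) \<partial>gauss_space N"
  have km: "?k * ?m = 1" unfolding of_real_mult[symmetric] by simp
  have kk: "?k * ?k = of_real (4 / pi)" unfolding of_real_mult[symmetric] by simp
  have c: "has_bochner_integral (gauss_space N) (\<lambda>x. gauss_phase N u x * cnj (complex_gauss N v x))
      (?m * cinner N u v)"
  proof -
    have "has_bochner_integral (gauss_space N) (\<lambda>x. cnj (complex_gauss N v x * cnj (gauss_phase N u x)))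
      (cnj (?m * cinner N v u))"
      by (rule has_bochner_integral_bounded_linear[OF bounded_linear_cnj complex_gauss_phase_covariance])
    moreover have "cnj (cinner N v u) = cinner N u v" by (simp add: cinner_def mult.commute)
    ultimately show ?thesis by (simp add: mult.commute)
  qed
  have "has_bochner_integral (gauss_space N)
    (\<lambda>x. complex_gauss N u x * cnj (complex_gauss N v x)
      - ?k * (complex_gauss N u x * cnj (gauss_phase N v x))
      - ?k * (gauss_phase N u x * cnj (complex_gauss N v x))
      + of_real (4 / pi) * (gauss_phase N u x * cnj (gauss_phase N v x)))
    (cinner N u v - ?k * (?m * cinner N u v) - ?k * (?m * cinner N u v) + of_real (4 / pi) * ?T)"
    by (intro has_bochner_integral_add has_bochner_integral_diff has_bochner_integral_mult_right
        complex_gauss_covariance complex_gauss_phase_covariance c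
        has_bochner_integral_integrable gauss_phase_covariance_integrable)
  moreover have "complex_gauss N u x * cnj (complex_gauss N v x)
      - ?k * (complex_gauss N u x * cnj (gauss_phase N v x))
      - ?k * (gauss_phase N u x * cnj (complex_gauss N v x))
      + of_real (4 / pi) * (gauss_phase N u x * cnj (gauss_phase N v x))
      = gauss_residual N u x * cnj (gauss_residual N v x)" for x
    unfolding kk[symmetric] gauss_residual_def by (simp add: algebra_simps)
  moreover have "cinner N u v - ?k * (?m * cinner N u v) - ?k * (?m * cinner N u v) + of_real (4 / pi) * ?T
     = of_real (4 / pi) * ?T - cinner N u v"
    unfolding mult.assoc[symmetric] km by simp
  ultimately show ?thesis by (simp only:)
qed

section \<open>Positive semidefinite matrices are Gram matrices\<close>

text \<open>Cholesky factorization, by induction on the size: the last column, divided by the root of the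
  last diagonal entry \<open>d\<close>, becomes a new coordinate, and what remains is the Schur complement, which is
  positive semidefinite again. If \<open>d = 0\<close>, positivity forces the last column to vanish, and since
  division by zero yields zero, the same formulas apply.\<close>

lemma psd_matrix_gram_factorization:
  fixes f :: "nat \<Rightarrow> nat \<Rightarrow> complex"
  assumes "\<And>i j. i < n \<Longrightarrow> j < n \<Longrightarrow> f j i = cnj (f i j)"
    and "\<And>c. 0 \<le> Re (\<Sum>i<n. \<Sum>j<n. c i * cnj (c j) * f i j)"
  shows "\<exists>y. \<forall>i<n. \<forall>j<n. f i j = cinner n (y i) (y j)"
  using assms
proof (induction n arbitrary: f)
  case 0
  then show ?case by simp
next
  case (Suc n)
  have herm: "f j i = cnj (f i j)" if "i \<le> n" "j \<le> n" for i j using Suc.prems(1)[of i j] that by simp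
  define d where "d = Re (f n n)"
  have d: "f n n = of_real d" using arg_cong[OF herm[OF order_refl order_refl], of Im]
    by (simp add: d_def complex_eq_iff)
  have expand: "(\<Sum>i<Suc n. \<Sum>j<Suc n. c i * cnj (c j) * f i j) =
      (\<Sum>i<n. \<Sum>j<n. c i * cnj (c j) * f i j) + (\<Sum>i<n. c i * f i n) * cnj (c n)
      + cnj (\<Sum>i<n. c i * f i n) * c n + of_real d * (c n * cnj (c n))" for c
  proof -
    have "(\<Sum>j<n. c n * cnj (c j) * f n j) = cnj (\<Sum>i<n. c i * f i n) * c n"
      unfolding cnj_sum sum_distrib_right
      by (rule sum.cong) (auto simp: herm[of _ n])
    moreover have "(\<Sum>i<n. c i * cnj (c n) * f i n) = (\<Sum>i<n. c i * f i n) * cnj (c n)"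
      unfolding sum_distrib_right by (rule sum.cong) auto
    ultimately show ?thesis by (simp add: sum.distrib d algebra_simps)
  qed
  have d0: "0 \<le> d"
    using Suc.prems(2)[of "\<lambda>i. if i = n then 1 else 0"] unfolding expand by simp
  have col: "f i n = 0" if "d = 0" "i < n" for i
  proof -
    \<comment> \<open>Test vectors supported on \<open>i\<close> and \<open>n\<close>: with \<open>d = 0\<close> the form is linear in the coefficient at
      \<open>n\<close>, so it can only be nonnegative if \<open>f i n = 0\<close>.\<close>
    have "0 \<le> Re (f i i) - t * (cmod (f i n))\<^sup>2" for t
    proof -
      let ?c = "\<lambda>k. if k = i then 1 else if k = n then - of_real (t / 2) * f i n else 0"
      have s: "(\<Sum>k<n. ?c k * g k) = g i" for g :: "nat \<Rightarrow> complex"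
      proof -
        have "(\<Sum>k<n. ?c k * g k) = (\<Sum>k<n. if k = i then g k else 0)"
          by (rule sum.cong) auto
        then show ?thesis using \<open>i < n\<close> by simp
      qed
      have s': "(\<Sum>k<n. cnj (?c k) * g k) = g i" for g :: "nat \<Rightarrow> complex"
        using arg_cong[OF s[of "\<lambda>k. cnj (g k)"], of cnj] by (simp only: cnj_sum complex_cnj_mult complex_cnj_cnj)
      have dbl: "(\<Sum>k<n. \<Sum>j<n. ?c k * cnj (?c j) * f k j) = f i i"
        unfolding mult.assoc sum_distrib_left[symmetric] s' s ..
      have "0 \<le> Re (f i i + f i n * cnj (?c n) + cnj (f i n) * ?c n)"
        using Suc.prems(2)[of ?c] unfolding expand dbl s using \<open>d = 0\<close> by simp
      also have "f i i + f i n * cnj (?c n) + cnj (f i n) * ?c n = f i i - of_real (t * (cmod (f i n))\<^sup>2)"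
      proof -
        have "f i n * cnj (?c n) + cnj (f i n) * ?c n = - of_real t * (f i n * cnj (f i n))"
          using \<open>i < n\<close> by (simp add: algebra_simps)
        also have "\<dots> = - of_real (t * (cmod (f i n))\<^sup>2)"
          unfolding of_real_mult complex_norm_square by simp
        finally show ?thesis by (simp add: algebra_simps)
      qed
      finally show ?thesis by simp
    qed
    from this[of "(Re (f i i) + 1) / (cmod (f i n))\<^sup>2"] show ?thesis by (cases "f i n = 0") auto
  qed
  define g where "g i j = f i j - f i n * f n j / of_real d" for i j
  have "\<exists>y. \<forall>i<n. \<forall>j<n. g i j = cinner n (y i) (y j)"
  proof (rule Suc.IH)
    show "g j i = cnj (g i j)" if "i < n" "j < n" for i j
      using that by (simp add: g_def herm[of i j] herm[of n j] herm[of i n])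
    show "0 \<le> Re (\<Sum>i<n. \<Sum>j<n. c i * cnj (c j) * g i j)" for c
    proof -
      define s where "s = (\<Sum>i<n. c i * f i n)"
      \<comment> \<open>The Schur complement is the minimum of the form over the last coefficient, attained at this
        value.\<close>
      define e where "e = c(n := - s / of_real d)"
      have s': "(\<Sum>j<n. cnj (c j) * f n j) = cnj s"
        unfolding s_def cnj_sum by (rule sum.cong) (auto simp: herm[of _ n])
      have "(\<Sum>i<n. \<Sum>j<n. c i * cnj (c j) * g i j)
        = (\<Sum>i<n. \<Sum>j<n. c i * cnj (c j) * f i j)
          - (\<Sum>i<n. \<Sum>j<n. (c i * f i n) * (cnj (c j) * f n j)) / of_real d"
        by (simp add: g_def sum_subtractf sum_divide_distrib algebra_simps)
      also have "(\<Sum>i<n. \<Sum>j<n. (c i * f i n) * (cnj (c j) * f n j)) = s * cnj s"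
        unfolding sum_distrib_left[symmetric] sum_distrib_right[symmetric] s' s_def ..
      also have "(\<Sum>i<n. \<Sum>j<n. c i * cnj (c j) * f i j) - s * cnj s / of_real d
          = (\<Sum>i<Suc n. \<Sum>j<Suc n. e i * cnj (e j) * f i j)"
      proof -
        have 1: "(\<Sum>i<n. \<Sum>j<n. e i * cnj (e j) * f i j) = (\<Sum>i<n. \<Sum>j<n. c i * cnj (c j) * f i j)"
          by (intro sum.cong) (auto simp: e_def)
        have 2: "(\<Sum>i<n. e i * f i n) = s"
          unfolding s_def by (intro sum.cong) (auto simp: e_def)
        show ?thesis unfolding expand 1 2 by (simp add: e_def field_simps)
      qed
      finally show ?thesis using Suc.prems(2)[of e] by simp
    qed
  qed
  then obtain y where y: "\<And>i j. i < n \<Longrightarrow> j < n \<Longrightarrow> g i j = cinner n (y i) (y j)" by auto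
  define z where "z i p = (if p = n then f i n / of_real (sqrt d) else if i = n then 0 else y i p)" for i p
  have sq: "complex_of_real (sqrt d) * of_real (sqrt d) = of_real d"
    unfolding of_real_mult[symmetric] using d0 by simp
  have "f i j = cinner (Suc n) (z i) (z j)" if "i < Suc n" "j < Suc n" for i j
  proof -
    have "cinner (Suc n) (z i) (z j) = (if i < n \<and> j < n then g i j else 0)
        + f i n * f n j / of_real d"
    proof -
      have "(\<Sum>p<n. z i p * cnj (z j p)) = (if i < n \<and> j < n then g i j else 0)"
        using that by (auto simp: z_def y cinner_def)
      moreover have "z i n * cnj (z j n) = f i n * f n j / of_real d"
        using herm[of j n] that by (simp add: z_def sq)
      ultimately show ?thesis by (simp add: cinner_def)
    qed
    moreover have "f i n * f n n / of_real d = f i n" if "i \<le> n" for i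
      using col[of i] that d by (cases "d = 0"; cases "i = n") auto
    moreover have "f n n * f n j / of_real d = f n j"
      using col[of j] herm[of j n] that d by (cases "d = 0"; cases "j = n") auto
    ultimately show ?thesis using that by (auto simp: g_def less_Suc_eq)
  qed
  then show ?case by blast
qed

section \<open>Grothendieck inequalities for vectors\<close>

definition form_bounded :: "nat \<Rightarrow> nat \<Rightarrow> (nat \<Rightarrow> nat \<Rightarrow> complex) \<Rightarrow> real \<Rightarrow> bool" where
  "form_bounded m n X b \<longleftrightarrow>
     (\<forall>s t. (\<forall>i<m. cmod (s i) \<le> 1) \<longrightarrow> (\<forall>j<n. cmod (t j) \<le> 1) \<longrightarrow>
        cmod (\<Sum>i<m. \<Sum>j<n. X i j * (t j * cnj (s i))) \<le> b)"

definition vector_form ::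
  "nat \<Rightarrow> nat \<Rightarrow> (nat \<Rightarrow> nat \<Rightarrow> complex) \<Rightarrow> nat \<Rightarrow> (nat \<Rightarrow> nat \<Rightarrow> complex) \<Rightarrow> (nat \<Rightarrow> nat \<Rightarrow> complex) \<Rightarrow> complex"
  where "vector_form m n X N u v = (\<Sum>i<m. \<Sum>j<n. X i j * cinner N (u j) (v i))"

text \<open>The residuals are square-integrable functions; their Gram matrix is realized by vectors in
  \<open>C^L\<close> so that the Grothendieck form can be applied to them again. Since \<open>4 / pi - 1 < 1\<close>,
  this is a contraction, on which the iteration for general forms rests.\<close>

lemma residual_gram_vectors:
  "\<exists>y. (\<forall>a<L. \<forall>b<L. cinner L (y a) (y b) =
        of_real (4 / pi) * (\<integral>x. gauss_phase N (w a) x * cnj (gauss_phase N (w b) x) \<partial>gauss_space N)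
        - cinner N (w a) (w b))
     \<and> (\<forall>a<L. (cnorm L (y a))\<^sup>2 \<le> (4 / pi - 1) * (cnorm N (w a))\<^sup>2)"
proof -
  define f where "f a b = (\<integral>x. gauss_residual N (w a) x * cnj (gauss_residual N (w b) x) \<partial>gauss_space N)" for a b
  have f: "f a b = of_real (4 / pi) * (\<integral>x. gauss_phase N (w a) x * cnj (gauss_phase N (w b) x) \<partial>gauss_space N)
        - cinner N (w a) (w b)" for a b
    unfolding f_def by (rule has_bochner_integral_integral_eq[OF gauss_residual_covariance])
  have int: "integrable (gauss_space N) (\<lambda>x. gauss_residual N (w a) x * cnj (gauss_residual N (w b) x))" for a b
    using gauss_residual_covariance by (rule integrable.intros)
  have "\<exists>y. \<forall>i<L. \<forall>j<L. f i j = cinner L (y i) (y j)"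
  proof (rule psd_matrix_gram_factorization)
    show "f j i = cnj (f i j)" for i j
      using Bochner_Integration.integral_cnj[of "gauss_space N"
          "\<lambda>x. gauss_residual N (w i) x * cnj (gauss_residual N (w j) x)"]
      unfolding f_def by (simp add: mult.commute)
    show "0 \<le> Re (\<Sum>i<L. \<Sum>j<L. c i * cnj (c j) * f i j)" for c
    proof -
      have "(\<Sum>i<L. \<Sum>j<L. c i * cnj (c j) * f i j)
        = (\<integral>x. (\<Sum>i<L. \<Sum>j<L. c i * cnj (c j) * (gauss_residual N (w i) x * cnj (gauss_residual N (w j) x)))
             \<partial>gauss_space N)"
        unfolding f_def
        by (subst Bochner_Integration.integral_sum Bochner_Integration.integrable_sum
            integral_mult_right_zero, (intro Bochner_Integration.integrable_sum integrable_mult_right int)?)+ simp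
      also have "\<dots> = (\<integral>x. complex_of_real ((cmod (\<Sum>i<L. c i * gauss_residual N (w i) x))\<^sup>2) \<partial>gauss_space N)"
        unfolding complex_norm_square cnj_sum sum_product complex_cnj_mult
        by (intro Bochner_Integration.integral_cong refl sum.cong) (simp add: algebra_simps)
      also have "\<dots> = of_real (\<integral>x. (cmod (\<Sum>i<L. c i * gauss_residual N (w i) x))\<^sup>2 \<partial>gauss_space N)"
        by (rule integral_complex_of_real)
      finally show ?thesis by simp
    qed
  qed
  then obtain y where y: "\<And>a b. a < L \<Longrightarrow> b < L \<Longrightarrow> f a b = cinner L (y a) (y b)" by blast
  have "(cnorm L (y a))\<^sup>2 \<le> (4 / pi - 1) * (cnorm N (w a))\<^sup>2" if "a < L" for a
  proof -
    let ?T = "\<lambda>x. gauss_phase N (w a) x * cnj (gauss_phase N (w a) x)"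
    have T: "Re (?T x) \<le> (cnorm N (w a))\<^sup>2" for x
      unfolding complex_norm_square[symmetric] Re_complex_of_real
      by (intro power_mono gauss_phase_norm norm_ge_zero)
    have "(cnorm L (y a))\<^sup>2 = Re (f a a)"
      unfolding y[OF that that] cinner_self by simp
    also have "\<dots> = 4 / pi * (\<integral>x. Re (?T x) \<partial>gauss_space N) - (cnorm N (w a))\<^sup>2"
      unfolding f cinner_self integral_Re[OF gauss_phase_covariance_integrable]
      by (simp only: minus_complex.sel Re_of_real_mult Re_complex_of_real)
    also have "(\<integral>x. Re (?T x) \<partial>gauss_space N) \<le> (cnorm N (w a))\<^sup>2"
      by (intro gauss_space.integral_le_const integrable_Re gauss_phase_covariance_integrable AE_I2 T)
    finally show ?thesis by (simp add: left_diff_distrib divide_right_mono mult_left_mono)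
  qed
  then show ?thesis using y f by (intro exI[of _ y]) auto
qed

text \<open>Up to the residual vectors \<open>y\<close>, the value of the form at vectors is \<open>4 / pi\<close> times the average of
  its values at the phases. The index maps \<open>f\<close> and \<open>g\<close> allow the columns and the rows to use the same
  family of vectors, as for positive matrices, or disjoint parts of it.\<close>

lemma vector_form_rounding:
  assumes X: "form_bounded m n X b"
    and w: "\<And>a. a < L \<Longrightarrow> cnorm N (w a) \<le> 1"
    and f: "\<And>j. j < n \<Longrightarrow> f j < L" and g: "\<And>i. i < m \<Longrightarrow> g i < L"
  shows "\<exists>y. (\<forall>a<L. (cnorm L (y a))\<^sup>2 \<le> 4 / pi - 1) \<and>
    cmod (vector_form m n X N (\<lambda>j. w (f j)) (\<lambda>i. w (g i))
        + vector_form m n X L (\<lambda>j. y (f j)) (\<lambda>i. y (g i))) \<le> 4 / pi * b"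
proof -
  define T where "T a = gauss_phase N (w a)" for a
  obtain y where y: "\<And>a b. a < L \<Longrightarrow> b < L \<Longrightarrow> cinner L (y a) (y b) =
        of_real (4 / pi) * (\<integral>x. T a x * cnj (T b x) \<partial>gauss_space N) - cinner N (w a) (w b)"
    and ny: "\<And>a. a < L \<Longrightarrow> (cnorm L (y a))\<^sup>2 \<le> (4 / pi - 1) * (cnorm N (w a))\<^sup>2"
    unfolding T_def using residual_gram_vectors[of L N w] by blast
  have int: "integrable (gauss_space N) (\<lambda>x. T a x * cnj (T b x))" for a b
    unfolding T_def by (rule gauss_phase_covariance_integrable)
  have bound: "cmod (\<Sum>i<m. \<Sum>j<n. X i j * (T (f j) x * cnj (T (g i) x))) \<le> b" for x
    using X order_trans[OF gauss_phase_norm w] f g unfolding form_bounded_def T_def by simp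
  have "vector_form m n X N (\<lambda>j. w (f j)) (\<lambda>i. w (g i)) + vector_form m n X L (\<lambda>j. y (f j)) (\<lambda>i. y (g i))
    = (\<Sum>i<m. \<Sum>j<n. of_real (4 / pi) * (X i j * (\<integral>x. T (f j) x * cnj (T (g i) x) \<partial>gauss_space N)))"
    unfolding vector_form_def sum.distrib[symmetric]
    by (intro sum.cong refl) (simp add: y f g algebra_simps)
  also have "\<dots> = of_real (4 / pi) *
      (\<integral>x. (\<Sum>i<m. \<Sum>j<n. X i j * (T (f j) x * cnj (T (g i) x))) \<partial>gauss_space N)"
    unfolding sum_distrib_left[symmetric]
    by (subst Bochner_Integration.integral_sum integral_mult_right_zero,
        (intro Bochner_Integration.integrable_sum integrable_mult_right int)?)+ simp
  also have "cmod \<dots> \<le> 4 / pi * b"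
  proof -
    have "cmod (\<integral>x. (\<Sum>i<m. \<Sum>j<n. X i j * (T (f j) x * cnj (T (g i) x))) \<partial>gauss_space N)
      \<le> (\<integral>x. cmod (\<Sum>i<m. \<Sum>j<n. X i j * (T (f j) x * cnj (T (g i) x))) \<partial>gauss_space N)"
      by (rule integral_norm_bound)
    also have "\<dots> \<le> b"
      by (intro gauss_space.integral_le_const integrable_norm AE_I2 bound
          Bochner_Integration.integrable_sum integrable_mult_right int)
    finally show ?thesis by (simp add: norm_mult norm_divide divide_right_mono)
  qed
  finally have "cmod (vector_form m n X N (\<lambda>j. w (f j)) (\<lambda>i. w (g i))
      + vector_form m n X L (\<lambda>j. y (f j)) (\<lambda>i. y (g i))) \<le> 4 / pi * b" .
  moreover have "(cnorm L (y a))\<^sup>2 \<le> 4 / pi - 1" if "a < L" for a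
  proof -
    have "(cnorm N (w a))\<^sup>2 \<le> 1" using w[OF that] by (simp add: power_le_one)
    moreover have "0 \<le> 4 / pi - 1" using pi_less_4 by simp
    ultimately show ?thesis using ny[OF that] mult_left_mono[of "(cnorm N (w a))\<^sup>2" 1 "4 / pi - 1"] by simp
  qed
  ultimately show ?thesis by blast
qed

lemma vector_form_scale:
  "vector_form m n X N (\<lambda>j p. c * u j p) v = c * vector_form m n X N u v"
  by (simp add: vector_form_def cinner_def sum_distrib_left algebra_simps)

lemma vector_form_diag_add:
  "vector_form n n X N (\<lambda>j p. u j p + c * v j p) (\<lambda>j p. u j p + c * v j p) =
     vector_form n n X N u u + c * vector_form n n X N v u + cnj c * vector_form n n X N u v
     + of_real ((cmod c)\<^sup>2) * vector_form n n X N v v"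
proof -
  have "cinner N (\<lambda>p. u j p + c * v j p) (\<lambda>p. u i p + c * v i p) =
    cinner N (u j) (u i) + c * cinner N (v j) (u i) + cnj c * cinner N (u j) (v i)
    + of_real ((cmod c)\<^sup>2) * cinner N (v j) (v i)" for i j
    unfolding complex_norm_square
    by (simp add: cinner_def sum.distrib[symmetric] sum_distrib_left algebra_simps)
  then show ?thesis
    by (simp add: vector_form_def sum.distrib sum_distrib_left algebra_simps)
qed

text \<open>Coordinate by coordinate, the form at vectors is a sum of values of the scalar form.\<close>

lemma vector_form_psd:
  assumes "\<And>c. 0 \<le> Re (\<Sum>i<n. \<Sum>j<n. X i j * (c j * cnj (c i)))"
    and "\<And>c. Im (\<Sum>i<n. \<Sum>j<n. X i j * (c j * cnj (c i))) = 0"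
  shows "0 \<le> Re (vector_form n n X N u u)" "Im (vector_form n n X N u u) = 0"
proof -
  have "vector_form n n X N u u = (\<Sum>p<N. \<Sum>i<n. \<Sum>j<n. X i j * (u j p * cnj (u i p)))"
  proof -
    have "vector_form n n X N u u = (\<Sum>i<n. \<Sum>p<N. \<Sum>j<n. X i j * (u j p * cnj (u i p)))"
      unfolding vector_form_def cinner_def sum_distrib_left by (intro sum.cong refl sum.swap)
    then show ?thesis by (simp only: sum.swap[of _ "{..<n}" "{..<N}"])
  qed
  then show "0 \<le> Re (vector_form n n X N u u)" "Im (vector_form n n X N u u) = 0"
    using assms[of "\<lambda>j. u j p" for p] by (simp_all only: Re_sum Im_sum sum_nonneg sum.neutral_const)
qed

text \<open>On the diagonal the contribution of the residuals has the favourable sign. Off the diagonal,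
  positivity at \<open>w - v\<close> bounds the real part of the form at \<open>(w, v)\<close> by the mean of the values at
  \<open>(w, w)\<close> and \<open>(v, v)\<close>, and a rotation of \<open>u\<close> turns the modulus into a real part.\<close>

lemma grothendieck_positive:
  assumes X: "form_bounded n n X b"
    and psd: "\<And>c. 0 \<le> Re (\<Sum>i<n. \<Sum>j<n. X i j * (c j * cnj (c i)))"
      "\<And>c. Im (\<Sum>i<n. \<Sum>j<n. X i j * (c j * cnj (c i))) = 0"
    and u: "\<And>j. j < n \<Longrightarrow> cnorm N (u j) \<le> 1" and v: "\<And>i. i < n \<Longrightarrow> cnorm N (v i) \<le> 1"
  shows "cmod (vector_form n n X N u v) \<le> 4 / pi * b"
proof -
  let ?Q = "vector_form n n X N"
  have diag: "Re (?Q w w) \<le> 4 / pi * b" if w: "\<And>j. j < n \<Longrightarrow> cnorm N (w j) \<le> 1" for w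
  proof -
    obtain y where y: "cmod (?Q w w + vector_form n n X n y y) \<le> 4 / pi * b"
      using vector_form_rounding[OF X, where L=n and w=w and f="\<lambda>j. j" and g="\<lambda>j. j"] w by blast
    have "Re (?Q w w) \<le> Re (?Q w w + vector_form n n X n y y)"
      using vector_form_psd(1)[where X=X, OF psd] by simp
    also have "\<dots> \<le> cmod (?Q w w + vector_form n n X n y y)" by (rule complex_Re_le_cmod)
    finally show ?thesis using y by simp
  qed
  have offdiag: "Re (?Q w v) \<le> 4 / pi * b" if w: "\<And>j. j < n \<Longrightarrow> cnorm N (w j) \<le> 1" for w
  proof -
    \<comment> \<open>Hermitian symmetry, from the fact that the form is real at \<open>w + \<i> v\<close>.\<close>
    have "Re (?Q v w) = Re (?Q w v)"
      using vector_form_psd(2)[where X=X, OF psd, of N "\<lambda>j p. w j p + \<i> * v j p"]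
        vector_form_psd(2)[where X=X, OF psd, of N w] vector_form_psd(2)[where X=X, OF psd, of N v]
      unfolding vector_form_diag_add by simp
    then have "2 * Re (?Q w v) \<le> Re (?Q w w) + Re (?Q v v)"
      using vector_form_psd(1)[where X=X, OF psd, of N "\<lambda>j p. w j p + (-1) * v j p"]
      unfolding vector_form_diag_add by simp
    then show ?thesis using diag[of w, OF w] diag[of v, OF v] by simp
  qed
  show ?thesis
  proof (cases "?Q u v = 0")
    case True
    then show ?thesis using offdiag[of u] u by simp
  next
    case False
    let ?c = "cnj (sgn (?Q u v))"
    have "cnorm N (\<lambda>p. ?c * u j p) = cnorm N (u j)" for j
      using False by (intro cnorm_unimodular_scale) (simp add: norm_sgn)
    then have "Re (?Q (\<lambda>j p. ?c * u j p) v) \<le> 4 / pi * b" using u by (intro offdiag) simp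
    moreover have "?Q (\<lambda>j p. ?c * u j p) v = of_real (cmod (?Q u v))"
      unfolding vector_form_scale using mult_cnj_sgn[of "?Q u v"] by (simp only: mult.commute)
    ultimately show ?thesis by simp
  qed
qed

text \<open>The supremum \<open>S\<close> has to range over vectors of all dimensions, because the residual vectors of a
  family in \<open>C^N\<close> live in \<open>C^(n + m)\<close>. Since it is finite, \<open>S \<le> (4 / pi) b + (4 / pi - 1) S\<close> can be solved
  for \<open>S\<close>, using \<open>4 / pi < 2\<close>.\<close>

lemma grothendieck_general:
  assumes X: "form_bounded m n X b"
    and u: "\<And>j. j < n \<Longrightarrow> cnorm N (u j) \<le> 1" and v: "\<And>i. i < m \<Longrightarrow> cnorm N (v i) \<le> 1"
  shows "cmod (vector_form m n X N u v) \<le> (4 / pi) / (2 - 4 / pi) * b"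
proof -
  define P where "P = {(N, u, v). (\<forall>j<n. cnorm N (u j) \<le> 1) \<and> (\<forall>i<m. cnorm N (v i) \<le> 1)}"
  define F where "F = (\<lambda>(N, u, v). cmod (vector_form m n X N u v))"
  define S where "S = (SUP q\<in>P. F q)"
  define k where "k = sqrt (4 / pi - 1)"
  have k: "0 < k" "k\<^sup>2 = 4 / pi - 1" using pi_less_4 by (auto simp: k_def)
  have bdd: "bdd_above (F ` P)"
  proof (rule bdd_aboveI2)
    fix q assume "q \<in> P"
    obtain N u v where q: "q = (N, u, v)" by (cases q)
    have "cmod (cinner N (u j) (v i)) \<le> 1" if "i < m" "j < n" for i j
    proof -
      have "cmod (cinner N (u j) (v i)) \<le> cnorm N (u j) * cnorm N (v i)" by (rule cinner_le)
      also have "\<dots> \<le> 1" using \<open>q \<in> P\<close> that unfolding q P_def by (intro mult_le_one) auto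
      finally show ?thesis .
    qed
    then show "F q \<le> (\<Sum>i<m. \<Sum>j<n. cmod (X i j))"
      unfolding F_def q vector_form_def
      by (auto intro!: sum_norm_le mult_left_le simp: norm_mult)
  qed
  have le: "F q \<le> S" if "q \<in> P" for q
    unfolding S_def using that bdd by (rule cSUP_upper)
  have "S \<le> 4 / pi * b + (4 / pi - 1) * S"
  proof -
    have ne: "P \<noteq> {}"
      unfolding P_def by (auto simp: cnorm_def intro!: exI[of _ 0])
    have step: "F q \<le> 4 / pi * b + (4 / pi - 1) * S" if "q \<in> P" for q
    proof -
      obtain N u v where q: "q = (N, u, v)" by (cases q)
      \<comment> \<open>Columns and rows share one family, so that residuals of both are realized in one space.\<close>
      define w where "w a = (if a < n then u a else v (a - n))" for a
      have "cnorm N (w a) \<le> 1" if "a < n + m" for a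
        using \<open>q \<in> P\<close> that by (auto simp: q P_def w_def)
      then obtain y where ny: "\<And>a. a < n + m \<Longrightarrow> (cnorm (n + m) (y a))\<^sup>2 \<le> 4 / pi - 1"
        and y: "cmod (vector_form m n X N (\<lambda>j. w j) (\<lambda>i. w (n + i))
          + vector_form m n X (n + m) (\<lambda>j. y j) (\<lambda>i. y (n + i))) \<le> 4 / pi * b"
        using vector_form_rounding[OF X, of "n + m" N w "\<lambda>j. j" "\<lambda>i. n + i"] by auto
      have wf: "vector_form m n X N (\<lambda>j. w j) (\<lambda>i. w (n + i)) = vector_form m n X N u v"
        unfolding vector_form_def by (intro sum.cong refl) (simp add: w_def)
      define z where "z a p = of_real (1 / k) * y a p" for a p
      have nz: "cnorm (n + m) (z a) \<le> 1" if "a < n + m" for a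
      proof -
        have "(cnorm (n + m) (z a))\<^sup>2 = (cnorm (n + m) (y a))\<^sup>2 / k\<^sup>2"
          by (simp add: cnorm_sq z_def norm_mult norm_divide power_divide sum_divide_distrib)
        also have "\<dots> \<le> 1" using ny[OF that] k(1) unfolding k(2)[symmetric] by simp
        finally show ?thesis by (simp add: power_le_one_iff)
      qed
      have "(n + m, z, \<lambda>i. z (n + i)) \<in> P" unfolding P_def using nz by auto
      from le[OF this] have zS: "cmod (vector_form m n X (n + m) z (\<lambda>i. z (n + i))) \<le> S"
        by (simp add: F_def)
      have yz: "vector_form m n X (n + m) (\<lambda>j. y j) (\<lambda>i. y (n + i))
          = of_real (k\<^sup>2) * vector_form m n X (n + m) z (\<lambda>i. z (n + i))"
      proof -
        have "cinner (n + m) (y j) (y i) = of_real (k\<^sup>2) * cinner (n + m) (z j) (z i)" for i j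
          using k(1) by (simp add: cinner_def z_def sum_distrib_left power2_eq_square)
        then show ?thesis by (simp add: vector_form_def sum_distrib_left mult.left_commute)
      qed
      have "F q \<le> cmod (vector_form m n X N u v + vector_form m n X (n + m) (\<lambda>j. y j) (\<lambda>i. y (n + i)))
          + cmod (vector_form m n X (n + m) (\<lambda>j. y j) (\<lambda>i. y (n + i)))"
        unfolding F_def q using norm_triangle_ineq4[of "vector_form m n X N u v
          + vector_form m n X (n + m) (\<lambda>j. y j) (\<lambda>i. y (n + i))"
          "vector_form m n X (n + m) (\<lambda>j. y j) (\<lambda>i. y (n + i))"] by simp
      also have "\<dots> \<le> 4 / pi * b + k\<^sup>2 * S"
        using y zS unfolding wf yz norm_mult by (intro add_mono) (auto intro: mult_left_mono simp: norm_power)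
      finally show ?thesis unfolding k .
    qed
    have "(SUP q\<in>P. F q) \<le> 4 / pi * b + (4 / pi - 1) * S" by (rule cSUP_least[OF ne step])
    then show ?thesis by (simp only: S_def[symmetric])
  qed
  then have "S * (2 - 4 / pi) \<le> 4 / pi * b" by (simp add: algebra_simps)
  moreover have "0 < 2 - 4 / pi" using pi_gt3 by (simp add: field_simps)
  ultimately have "S \<le> (4 / pi) / (2 - 4 / pi) * b"
    using pos_le_divide_eq[of "2 - 4 / pi" S "4 / pi * b"] by (simp only: times_divide_eq_left)
  moreover have "F (N, u, v) \<le> S" by (rule le) (use u v in \<open>auto simp: P_def\<close>)
  ultimately show ?thesis by (simp add: F_def)
qed

section \<open>From the completely bounded norm to vectors\<close>

lemma sum_rotate:
  "(\<Sum>t\<in>T. \<Sum>p\<in>P. \<Sum>i\<in>I. \<Sum>j\<in>J. f t p i j) = (\<Sum>p\<in>P. \<Sum>i\<in>I. \<Sum>j\<in>J. \<Sum>t\<in>T. f t p i j)"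
  by (subst sum.swap, rule sum.cong[OF refl], subst sum.swap, rule sum.cong[OF refl], rule sum.swap)

lemma l2_norm_eq_cnorm: "l2_norm v = cnorm (dim_vec v) (\<lambda>p. v $ p)"
  by (simp add: l2_norm_def cnorm_def L2_set_def)

lemma op_norm_le_one_contractive:
  assumes A: "A \<in> carrier_mat k k" "op_norm A \<le> 1" and v: "v \<in> carrier_vec k"
  shows "l2_norm (A *\<^sub>v v) \<le> l2_norm v"
proof (cases "l2_norm v = 0")
  case True
  then have "\<forall>p<k. v $ p = 0"
    using v by (simp add: l2_norm_eq_cnorm cnorm_eq_0_iff)
  then have "v = 0\<^sub>v k" using v by (intro eq_vecI) auto
  then show ?thesis using A True
    by (simp add: l2_norm_eq_cnorm cnorm_def scalar_prod_def)
next
  case False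
  define r where "r = l2_norm v"
  have r: "0 < r" using False by (simp add: r_def l2_norm_eq_cnorm less_le)
  have scale: "l2_norm (c \<cdot>\<^sub>v w) = cmod c * l2_norm w" for c w
    by (simp add: l2_norm_eq_cnorm cnorm_def norm_mult power_mult_distrib
        sum_distrib_left[symmetric] real_sqrt_mult)
  let ?w = "complex_of_real (1 / r) \<cdot>\<^sub>v v"
  have "l2_norm (A *\<^sub>v ?w) \<le> op_norm A"
    unfolding op_norm_def
    by (rule cSUP_upper[OF _ bdd_above_op_norm]) (use v A r in \<open>auto simp: scale r_def norm_divide\<close>)
  also have "\<dots> \<le> 1" by (rule A(2))
  also have "A *\<^sub>v ?w = complex_of_real (1 / r) \<cdot>\<^sub>v (A *\<^sub>v v)"
    using A v by (simp add: mult_mat_vec)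
  finally show ?thesis using A r unfolding scale r_def[symmetric] by (simp add: norm_divide divide_le_eq)
qed

text \<open>For \<open>w = A^* v\<close> one has \<open>\<parallel>w\<parallel>^2 = <A w, v> \<le> \<parallel>w\<parallel> \<parallel>v\<parallel>\<close>.\<close>

lemma op_norm_le_one_adjoint_contractive:
  assumes A: "A \<in> carrier_mat k k" "op_norm A \<le> 1" and v: "v \<in> carrier_vec k"
  shows "cnorm k (\<lambda>p. \<Sum>s<k. cnj (A $$ (s, p)) * v $ s) \<le> l2_norm v"
proof -
  define w where "w = Matrix.vec k (\<lambda>p. \<Sum>s<k. cnj (A $$ (s, p)) * v $ s)"
  have w: "w \<in> carrier_vec k" by (simp add: w_def)
  have nw: "l2_norm w = cnorm k (\<lambda>p. \<Sum>s<k. cnj (A $$ (s, p)) * v $ s)"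
    by (simp add: l2_norm_eq_cnorm w_def cnorm_def)
  have Aw: "(A *\<^sub>v w) $ s = (\<Sum>p<k. A $$ (s, p) * w $ p)" if "s < k" for s
    using A w that by (simp add: scalar_prod_def lessThan_atLeast0)
  have "cinner k (\<lambda>p. (A *\<^sub>v w) $ p) (\<lambda>p. v $ p) = cinner k (\<lambda>p. w $ p) (\<lambda>p. w $ p)"
  proof -
    have "cinner k (\<lambda>p. (A *\<^sub>v w) $ p) (\<lambda>p. v $ p) = (\<Sum>s<k. \<Sum>p<k. A $$ (s, p) * w $ p * cnj (v $ s))"
      by (simp add: cinner_def Aw sum_distrib_right)
    also have "\<dots> = (\<Sum>p<k. \<Sum>s<k. A $$ (s, p) * w $ p * cnj (v $ s))" by (rule sum.swap)
    also have "\<dots> = cinner k (\<lambda>p. w $ p) (\<lambda>p. w $ p)"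
      unfolding cinner_def
      by (intro sum.cong refl) (simp add: w_def sum_distrib_left cnj_sum algebra_simps)
    finally show ?thesis .
  qed
  then have "complex_of_real ((l2_norm w)\<^sup>2) = cinner k (\<lambda>p. (A *\<^sub>v w) $ p) (\<lambda>p. v $ p)"
    using w by (simp add: cinner_self l2_norm_eq_cnorm)
  then have "(l2_norm w)\<^sup>2 = cmod (cinner k (\<lambda>p. (A *\<^sub>v w) $ p) (\<lambda>p. v $ p))"
    by (metis norm_of_real abs_of_nonneg zero_le_power2)
  also have "\<dots> \<le> l2_norm (A *\<^sub>v w) * l2_norm v"
    using cinner_le[of k "\<lambda>p. (A *\<^sub>v w) $ p" "\<lambda>p. v $ p"] A v by (simp add: l2_norm_eq_cnorm)
  also have "\<dots> \<le> l2_norm w * l2_norm v"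
    by (rule mult_right_mono[OF op_norm_le_one_contractive[OF A w]]) (simp add: l2_norm_eq_cnorm)
  finally have "l2_norm w * l2_norm w \<le> l2_norm w * l2_norm v" by (simp add: power2_eq_square)
  moreover have "0 \<le> l2_norm w" "0 \<le> l2_norm v" by (simp_all add: l2_norm_eq_cnorm)
  ultimately have "l2_norm w \<le> l2_norm v" by (cases "l2_norm w = 0") auto
  then show ?thesis unfolding nw .
qed

text \<open>To bound the amplified form \<open>M = \<Sum> X_ij a_i b_j\<close> at a vector \<open>v\<close>, put \<open>e = M v\<close>. Then \<open>\<parallel>e\<parallel>^2\<close> is the
  Grothendieck form at the vectors \<open>b_j v\<close>, of norm at most \<open>1\<close>, and \<open>a_i^* e\<close>, of norm at most \<open>\<parallel>e\<parallel>\<close>,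
  so that it is at most \<open>C \<parallel>e\<parallel>\<close>.\<close>

lemma norm_cbB_le_vector_bound:
  assumes X: "X \<in> carrier_mat m n" and C: "0 \<le> C"
    and bound: "\<And>N u v. (\<And>j. j < n \<Longrightarrow> cnorm N (u j) \<le> 1) \<Longrightarrow> (\<And>i. i < m \<Longrightarrow> cnorm N (v i) \<le> 1) \<Longrightarrow>
      cmod (vector_form m n (\<lambda>i j. X $$ (i, j)) N u v) \<le> C"
  shows "norm_cbB X \<le> ennreal C"
  unfolding norm_cbB_def bilinear_norm_def
proof (intro SUP_least, clarify)
  fix k :: nat and a b :: "complex Matrix.vec mat"
  assume "a \<in> matrices_over k (dim_row X)" "matrices_over_norm (dim_row X) a \<le> 1"
    and "b \<in> matrices_over k (dim_col X)" "matrices_over_norm (dim_col X) b \<le> 1"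
  then have a: "a \<in> carrier_mat k k" "matrices_over_norm m a \<le> 1"
    and b: "b \<in> carrier_mat k k" "matrices_over_norm n b \<le> 1"
    using X by (auto simp: matrices_over_def)
  define A where "A i = map_mat (\<lambda>x. x $ i) a" for i
  define B where "B j = map_mat (\<lambda>x. x $ j) b" for j
  have A: "A i \<in> carrier_mat k k" and B: "B i \<in> carrier_mat k k" for i
    using a b by (auto simp: A_def B_def)
  have nA: "op_norm (A i) \<le> 1" if "i < m" for i
    using a(2) that unfolding matrices_over_norm_def by (auto simp: A_def)
  have nB: "op_norm (B j) \<le> 1" if "j < n" for j
    using b(2) that unfolding matrices_over_norm_def by (auto simp: B_def)
  let ?M = "amplification k (kernel_form X) a b"
  have M: "?M \<in> carrier_mat k k" by (simp add: amplification_def)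
  have Mij: "?M $$ (s, t) = (\<Sum>p<k. \<Sum>i<m. \<Sum>j<n. A i $$ (s, p) * X $$ (i, j) * B j $$ (p, t))"
    if "s < k" "t < k" for s t
    using that a b X by (simp add: amplification_def kernel_form_def A_def B_def)
  have "l2_norm (?M *\<^sub>v v) \<le> C" if v: "v \<in> carrier_vec k" "l2_norm v \<le> 1" for v
  proof -
    define e where "e = ?M *\<^sub>v v"
    have e: "e \<in> carrier_vec k" unfolding e_def using M v(1) by (rule mult_mat_vec_carrier)
    define r where "r = l2_norm e"
    have r0: "0 \<le> r" by (simp add: r_def l2_norm_eq_cnorm)
    define u where "u j p = (B j *\<^sub>v v) $ p" for j p
    define w where "w i p = (\<Sum>s<k. cnj (A i $$ (s, p)) * e $ s)" for i p
    have nu: "cnorm k (u j) \<le> 1" if "j < n" for j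
      using op_norm_le_one_contractive[OF B nB[OF that] v(1)] B[of j] v(2)
      by (simp add: l2_norm_eq_cnorm[of "B j *\<^sub>v v"] u_def[abs_def])
    have nw: "cnorm k (w i) \<le> r" if "i < m" for i
      using op_norm_le_one_adjoint_contractive[OF A nA[OF that] e] by (simp add: w_def[abs_def] r_def)
    have uj: "u j p = (\<Sum>t<k. B j $$ (p, t) * v $ t)" if "p < k" for j p
      using B[of j] v that by (simp add: u_def scalar_prod_def lessThan_atLeast0)
    have es: "e $ s = (\<Sum>t<k. ?M $$ (s, t) * v $ t)" if "s < k" for s
      using M v that by (simp add: e_def scalar_prod_def lessThan_atLeast0)
    have "complex_of_real (r\<^sup>2) = (\<Sum>s<k. e $ s * cnj (e $ s))"
      using cinner_self[of k "\<lambda>p. e $ p"] e by (simp add: r_def l2_norm_eq_cnorm cinner_def)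
    also have "\<dots> = (\<Sum>s<k. \<Sum>p<k. \<Sum>i<m. \<Sum>j<n. A i $$ (s, p) * X $$ (i, j) * u j p * cnj (e $ s))"
    proof (rule sum.cong[OF refl])
      fix s assume "s \<in> {..<k}"
      then have "e $ s = (\<Sum>t<k. \<Sum>p<k. \<Sum>i<m. \<Sum>j<n. A i $$ (s, p) * X $$ (i, j) * B j $$ (p, t) * v $ t)"
        by (simp add: es Mij sum_distrib_right)
      also have "\<dots> = (\<Sum>p<k. \<Sum>i<m. \<Sum>j<n. A i $$ (s, p) * X $$ (i, j) * u j p)"
        by (subst sum_rotate, intro sum.cong refl) (simp add: uj sum_distrib_left mult.assoc)
      finally show "e $ s * cnj (e $ s)
          = (\<Sum>p<k. \<Sum>i<m. \<Sum>j<n. A i $$ (s, p) * X $$ (i, j) * u j p * cnj (e $ s))"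
        by (simp only: sum_distrib_right)
    qed
    also have "\<dots> = (\<Sum>p<k. \<Sum>i<m. \<Sum>j<n. X $$ (i, j) * (u j p * cnj (w i p)))"
      by (subst sum_rotate, intro sum.cong refl) (simp add: w_def sum_distrib_left algebra_simps)
    also have "\<dots> = vector_form m n (\<lambda>i j. X $$ (i, j)) k u w"
      unfolding vector_form_def cinner_def sum_distrib_left
      by (subst sum.swap, rule sum.cong[OF refl], rule sum.swap)
    finally have "r\<^sup>2 = cmod (vector_form m n (\<lambda>i j. X $$ (i, j)) k u w)"
      by (metis norm_of_real abs_of_nonneg zero_le_power2)
    also have "\<dots> \<le> r * C"
    proof (cases "r = 0")
      case True
      then have "w i p = 0" if "i < m" "p < k" for i p
        using nw[OF that(1)] that(2) cnorm_eq_0_iff[of k "w i"] cnorm_nonneg[of k "w i"] True by simp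
      then show ?thesis using True by (simp add: vector_form_def cinner_def)
    next
      case False
      then have r: "0 < r" using r0 by simp
      define z where "z i p = of_real (1 / r) * w i p" for i p
      have "cnorm k (z i) \<le> 1" if "i < m" for i
      proof -
        have "(cnorm k (z i))\<^sup>2 = (cnorm k (w i))\<^sup>2 / r\<^sup>2"
          by (simp add: cnorm_sq z_def norm_mult norm_divide power_divide sum_divide_distrib)
        also have "\<dots> \<le> 1" using nw[OF that] r by (simp add: power_mono)
        finally show ?thesis by (simp add: power_le_one_iff)
      qed
      then have "cmod (vector_form m n (\<lambda>i j. X $$ (i, j)) k u z) \<le> C" by (intro bound nu)
      moreover have "vector_form m n (\<lambda>i j. X $$ (i, j)) k u w
          = of_real r * vector_form m n (\<lambda>i j. X $$ (i, j)) k u z"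
        using r by (simp add: vector_form_def cinner_def z_def sum_distrib_left)
      ultimately show ?thesis using r by (simp add: norm_mult)
    qed
    finally have "r * r \<le> r * C" by (simp add: power2_eq_square)
    then show ?thesis using r0 C by (cases "r = 0") (auto simp: r_def e_def)
  qed
  then have "op_norm ?M \<le> C"
    unfolding op_norm_def using M
    by (intro cSUP_least) (auto simp: l2_norm_eq_cnorm cnorm_def intro!: exI[of _ "0\<^sub>v k"])
  then show "ennreal (op_norm ?M) \<le> ennreal C" by (rule ennreal_leI)
qed

lemma norm_B_form_bounded:
  assumes X: "X \<in> carrier_mat m n" and b: "norm_B X = ennreal b" "0 \<le> b"
  shows "form_bounded m n (\<lambda>i j. X $$ (i, j)) b"
  unfolding form_bounded_def
proof (intro allI impI)
  fix s t :: "nat \<Rightarrow> complex"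
  assume s: "\<forall>i<m. cmod (s i) \<le> 1" and t: "\<forall>j<n. cmod (t j) \<le> 1"
  let ?s = "Matrix.vec m (\<lambda>i. cnj (s i))" and ?t = "Matrix.vec n t"
  have "ennreal (cmod (kernel_form X ?s ?t)) \<le> norm_B X"
    unfolding norm_B_def bilinear_norm_def
    by (rule SUP_upper2[of "(?s, ?t)"]) (use X s t in \<open>auto simp: sup_norm_def\<close>)
  then have "cmod (kernel_form X ?s ?t) \<le> b" using b by simp
  also have "kernel_form X ?s ?t = (\<Sum>i<m. \<Sum>j<n. X $$ (i, j) * (t j * cnj (s i)))"
    using X by (simp add: kernel_form_def algebra_simps)
  finally show "cmod (\<Sum>i<m. \<Sum>j<n. X $$ (i, j) * (t j * cnj (s i))) \<le> b" .
qed

lemma positive_matrix_form: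
  assumes X: "X \<in> carrier_mat n n" "positive_matrix X"
  shows "0 \<le> Re (\<Sum>i<n. \<Sum>j<n. X $$ (i, j) * (c j * cnj (c i)))"
    and "Im (\<Sum>i<n. \<Sum>j<n. X $$ (i, j) * (c j * cnj (c i))) = 0"
proof -
  have "0 \<le> (X *\<^sub>v Matrix.vec n c) \<bullet>c Matrix.vec n c" using X unfolding positive_matrix_def by auto
  also have "(X *\<^sub>v Matrix.vec n c) \<bullet>c Matrix.vec n c = (\<Sum>i<n. \<Sum>j<n. X $$ (i, j) * (c j * cnj (c i)))"
    using X by (simp add: scalar_prod_def lessThan_atLeast0 sum_distrib_right mult.assoc)
  finally show "0 \<le> Re (\<Sum>i<n. \<Sum>j<n. X $$ (i, j) * (c j * cnj (c i)))"
    and "Im (\<Sum>i<n. \<Sum>j<n. X $$ (i, j) * (c j * cnj (c i))) = 0"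
    by (simp_all add: complex_nonneg_iff)
qed

theorem proposition3p1:
  shows "(\<forall>n. \<forall>X \<in> carrier_mat n n. positive_matrix X \<longrightarrow>
            norm_cbB X \<le> ennreal kG * norm_B X)
       \<and> (\<forall>m n. \<forall>X \<in> carrier_mat m n.
            norm_cbB X \<le> ennreal (kG / (2 - kG)) * norm_B X)"
proof (intro conjI allI ballI impI)
  have kG: "0 < kG" "0 < kG / (2 - kG)"
    using pi_gt3 by (simp_all add: kG_def field_simps)
  fix m n :: nat
  show "norm_cbB X \<le> ennreal kG * norm_B X" if X: "X \<in> carrier_mat n n" "positive_matrix X" for X
  proof (cases "norm_B X")
    case (real b)
    have "norm_cbB X \<le> ennreal (kG * b)"
      unfolding kG_def using real kG(1)
      by (intro norm_cbB_le_vector_bound[OF X(1)]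
          grothendieck_positive[OF norm_B_form_bounded[OF X(1)] positive_matrix_form[OF X]]) auto
    then show ?thesis using real kG by (simp add: ennreal_mult)
  next
    case top
    then show ?thesis using kG by (simp add: ennreal_mult_top)
  qed
  show "norm_cbB X \<le> ennreal (kG / (2 - kG)) * norm_B X" if X: "X \<in> carrier_mat m n" for X
  proof (cases "norm_B X")
    case (real b)
    have "norm_cbB X \<le> ennreal (kG / (2 - kG) * b)"
    proof (rule norm_cbB_le_vector_bound[OF X])
      show "0 \<le> kG / (2 - kG) * b" using real(1) kG(2) by (intro mult_nonneg_nonneg) auto
    qed (unfold kG_def, rule grothendieck_general[OF norm_B_form_bounded[OF X real(2,1)]])
    then show ?thesis unfolding real(2) using real(1) kG(2) by (subst ennreal_mult[symmetric]) auto
  next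
    case top
    then show ?thesis using kG by (auto simp: ennreal_mult_top)
  qed
qed

end
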